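(* Let $n,d\in\mathbb{N}$, $\mu\in(0,n]$, $q\in(0,d]$, and let $f\colon\mathbb{R}^n\to\mathbb{R}^d$ be continuous. For $E\subset\mathbb{R}^n$ define $$\Psi(E)=\lim_{\delta\to0}\inf\Bigl\{\sum_\alpha(\operatorname{diam}D_\alpha)^{\mu}[\operatorname{diam}f(D_\alpha)]^q:\ D_\alpha\text{ compact},\ \operatorname{diam}D_\alpha\le\delta,\ E\subset\bigcup_{\alpha\in\mathbb{N}}D_\alpha\Bigr\}.$$ Then $\Psi$ is countably subadditive, and for every $E\subset\mathbb{R}^n$ and every $\lambda>0$, $$\mathcal{H}^q\bigl(\{y\in\mathbb{R}^d:\ \mathcal{H}^\mu(E\cap f^{-1}(y))\ge\lambda\}\bigr)\le 5\,\frac{\Psi(E)}{\lambda}.$$ *)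

theory Defs
  imports "HOL-Analysis.Analysis"
begin

text \<open>Unnormalized s-dimensional Hausdorff outer measure on a metric space:
  lim_{delta -> 0} inf { sum_i (diam C_i)^s : countable cover of E by bounded sets C_i
  with diam C_i <= delta }.  The delta-premeasure increases as delta decreases, so the
  limit is the supremum over delta > 0.\<close>
definition hausdorff_outer :: "real \<Rightarrow> 'a::metric_space set \<Rightarrow> ennreal" where
  "hausdorff_outer s E =
     (SUP \<delta>\<in>{0<..}. INF C \<in> {C :: nat \<Rightarrow> 'a set.
         (\<forall>i. bounded (C i) \<and> diameter (C i) \<le> \<delta>) \<and> E \<subseteq> (\<Union>i. C i)}.
        (\<Sum>i. ennreal (diameter (C i) powr s)))"

definition Psi :: "real \<Rightarrow> real \<Rightarrow> ('a::metric_space \<Rightarrow> 'b::metric_space) \<Rightarrow> 'a set \<Rightarrow> ennreal" where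
  "Psi \<mu> q f E =
     (SUP \<delta>\<in>{0<..}. INF D \<in> {D :: nat \<Rightarrow> 'a set.
         (\<forall>i. compact (D i) \<and> diameter (D i) \<le> \<delta>) \<and> E \<subseteq> (\<Union>i. D i)}.
        (\<Sum>i. ennreal (diameter (D i) powr \<mu> * diameter (f ` D i) powr q)))"

end

theory Submission
  imports Defs
begin

text \<open>Both \<open>\<Psi>\<close> and the Hausdorff outer measures are limits of premeasures over covers by small sets,
  hence metric outer measures, for which Borel sets are measurable. A cover \<open>D i\<close> of \<open>E\<close> that is
  nearly optimal for \<open>\<Psi>\<close> (and may be chosen so that the images are small as well) gives on
  \<open>{y. \<lambda> \<le> H\<^sup>\<mu> (E \<inter> f -` {y})}\<close> the inequality
  \<open>\<lambda>/2 \<le> (\<Sum>i. (diameter (D i))\<^sup>\<mu> * indicator (f ` D i) y)\<close>. So the images \<open>f ` D i\<close>, with weights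
  \<open>2 (diameter (D i))\<^sup>\<mu> / \<lambda>\<close>, form a weighted cover of cost about \<open>2 \<Psi>(E) / \<lambda>\<close>. The Hausdorff
  measure of a Borel set having arbitrarily fine weighted covers of cost at most \<open>M\<close> is at most
  \<open>2 M\<close>: a greedy selection shows that it is finite, and a density argument with the Vitali covering
  lemma then removes the dimensional constant. This yields the constant 4.\<close>

section \<open>Metric outer measures\<close>

text \<open>Caratheodory's criterion: only superadditivity over sets at positive distance is
  assumed, since the reverse inequality follows from countable subadditivity.\<close>

locale metric_outer_measure =
  fixes P :: "'a::metric_space set \<Rightarrow> ennreal"
  assumes empty [simp]: "P {} = 0"
    and mono: "A \<subseteq> B \<Longrightarrow> P A \<le> P B"
    and countably_subadditive: "P (\<Union>i::nat. A' i) \<le> (\<Sum>i. P (A' i))"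
    and separated: "0 < r \<Longrightarrow> (\<And>x y. x \<in> A \<Longrightarrow> y \<in> B \<Longrightarrow> r \<le> dist x y) \<Longrightarrow> P A + P B \<le> P (A \<union> B)"
begin

lemma subadditive: "P (A \<union> B) \<le> P A + P B"
proof -
  define A' where "A' = (\<lambda>i::nat. if i = 0 then A else if i = 1 then B else {})"
  have "A \<union> B = (\<Union>i. A' i)"
    by (auto simp: A'_def split: if_splits)
  then have "P (A \<union> B) \<le> (\<Sum>i. P (A' i))"
    using countably_subadditive[of A'] by simp
  also have "\<dots> = (\<Sum>i\<in>{0,1}. P (A' i))"
    by (rule suminf_finite) (auto simp: A'_def)
  finally show ?thesis by (simp add: A'_def)
qed

text \<open>The shells \<open>T k\<close> approach \<open>F\<close> as \<open>k\<close> grows. Since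
  \<open>infdist\<close> is 1-Lipschitz, the gap between \<open>\<alpha> m\<close> and
  \<open>\<beta> (Suc m)\<close> separates \<open>T (Suc m)\<close> from all earlier shells at once,
  so \<open>separated\<close> applies inductively.\<close>

lemma sum_separated_le:
  assumes T: "\<And>k x. x \<in> T k \<Longrightarrow> \<alpha> k \<le> infdist x F \<and> infdist x F < \<beta> k"
    and \<alpha>: "\<And>j k. j \<le> k \<Longrightarrow> \<alpha> k \<le> \<alpha> j" and \<beta>: "\<And>k. \<beta> (Suc k) < \<alpha> k"
  shows "(\<Sum>k<n. P (T k)) \<le> P (\<Union>k<n. T k)"
proof (induction n)
  case (Suc n)
  show ?case
  proof (cases n)
    case 0
    then show ?thesis by (simp add: lessThan_Suc)
  next
    case (Suc m)
    have "\<alpha> m - \<beta> n \<le> dist x y" if "x \<in> (\<Union>k<n. T k)" "y \<in> T n" for x y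
    proof -
      from that obtain k where k: "k < n" "x \<in> T k" by auto
      have "\<alpha> m \<le> infdist x F" using T[OF k(2)] \<alpha>[of k m] k(1) Suc by auto
      moreover have "infdist y F < \<beta> n" using T that by auto
      ultimately show ?thesis using infdist_triangle[of x F y] by linarith
    qed
    moreover have "0 < \<alpha> m - \<beta> n" using \<beta>[of m] Suc by simp
    ultimately have "P (\<Union>k<n. T k) + P (T n) \<le> P ((\<Union>k<n. T k) \<union> T n)"
      by (intro separated) auto
    with add_right_mono[OF Suc.IH, of "P (T n)"] show ?thesis
      by (simp only: lessThan_Suc Un_commute add.commute sum.insert finite_lessThan UN_insert lessThan_iff less_irrefl not_False_eq_True)
  qed
qed simp

text \<open>The shells R k and R (k+2) have positive distance, so the measures of the even and of the
  odd shells are both summable.\<close>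
lemma closed_caratheodory:
  assumes "closed F"
  shows "P (X \<inter> F) + P (X - F) \<le> P X"
proof (cases "F = {} \<or> P X = \<infinity>")
  case True
  then show ?thesis by auto
next
  case False
  \<comment> \<open>\<open>infdist x {}\<close> is 0 by convention, so the shells describe the
    distance to \<open>F\<close> only when \<open>F\<close> is nonempty. Finiteness of
    \<open>P X\<close> makes the shell sums converge.\<close>
  then have F: "F \<noteq> {}" and fin: "P X \<noteq> \<infinity>" by auto
  define A where "A n = {x \<in> X. 1 / (real n + 1) \<le> infdist x F}" for n
  define R where "R n = {x \<in> X. 1 / (real n + 2) \<le> infdist x F \<and> infdist x F < 1 / (real n + 1)}" for n
  have A_le: "P (X \<inter> F) + P (A n) \<le> P X" for n
  proof -
    have "P (X \<inter> F) + P (A n) \<le> P ((X \<inter> F) \<union> A n)"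
    proof (rule separated)
      show "0 < 1 / (real n + 1)" by simp
      show "1 / (real n + 1) \<le> dist x y" if "x \<in> X \<inter> F" "y \<in> A n" for x y
      proof -
        have "1 / (real n + 1) \<le> infdist y F" using that by (auto simp: A_def)
        also have "\<dots> \<le> dist y x" using that by (intro infdist_le) auto
        finally show ?thesis by (simp add: dist_commute)
      qed
    qed
    also have "\<dots> \<le> P X" by (rule mono) (auto simp: A_def)
    finally show ?thesis .
  qed
  have R_even: "(\<Sum>k<n. P (R (2 * k))) \<le> P X" for n
  proof -
    have "(\<Sum>k<n. P (R (2 * k))) \<le> P (\<Union>k<n. R (2 * k))"
      by (rule sum_separated_le[where \<alpha> = "\<lambda>k. 1 / (2 * real k + 2)" and \<beta> = "\<lambda>k. 1 / (2 * real k + 1)" and F = F])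
        (auto simp: R_def field_simps)
    also have "\<dots> \<le> P X" by (rule mono) (auto simp: R_def)
    finally show ?thesis .
  qed
  have R_odd: "(\<Sum>k<n. P (R (2 * k + 1))) \<le> P X" for n
  proof -
    have "(\<Sum>k<n. P (R (2 * k + 1))) \<le> P (\<Union>k<n. R (2 * k + 1))"
      by (rule sum_separated_le[where \<alpha> = "\<lambda>k. 1 / (2 * real k + 3)" and \<beta> = "\<lambda>k. 1 / (2 * real k + 2)" and F = F])
        (auto simp: R_def field_simps)
    also have "\<dots> \<le> P X" by (rule mono) (auto simp: R_def)
    finally show ?thesis .
  qed
  have "(\<Sum>k<n. P (R k)) \<le> P X + P X" for n
  proof -
    have "(\<Sum>k<n. P (R k)) \<le> (\<Sum>k<2 * n. P (R k))"
      by (rule sum_mono2) auto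
    also have "\<dots> = (\<Sum>k<n. P (R (2 * k))) + (\<Sum>k<n. P (R (2 * k + 1)))"
      by (induction n) (simp_all add: ac_simps)
    also have "\<dots> \<le> P X + P X" by (intro add_mono R_even R_odd)
    finally show ?thesis .
  qed
  then have "(\<Sum>k. P (R k)) \<le> P X + P X" by (intro suminf_le_const summableI)
  with fin have Rfin: "(\<Sum>k. P (R k)) \<noteq> \<infinity>"
    by (auto simp: top_unique)
  define r where "r k = enn2real (P (R k))" for k
  have r: "P (R k) = ennreal (r k)" for k
    using ennreal_suminf_lessD[of "\<lambda>k. P (R k)" top k] Rfin by (simp add: r_def less_top)
  have r0: "0 \<le> r k" for k by (simp add: r_def)
  have rs: "summable r" using Rfin r r0 by (intro summable_suminf_not_top) auto
  \<comment> \<open>\<open>X - F\<close> differs from \<open>A n\<close>, which is separated from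
    \<open>F\<close>, only by a tail of the shells, and this tail has small measure.\<close>
  have "P (X \<inter> F) + P (X - F) \<le> P X + ennreal e" if "0 < e" for e
  proof -
    obtain n where n: "norm (\<Sum>i. r (i + n)) < e"
      using suminf_exist_split[OF \<open>0 < e\<close> rs] by auto
    \<comment> \<open>As \<open>F\<close> is closed, each point has positive distance from
      \<open>F\<close>. The least \<open>k\<close> with \<open>1 / (k + 1)\<close> below this
      distance places the point in \<open>A n\<close> if \<open>k \<le> n\<close>, and otherwise in
      the shell with index \<open>k - 1\<close>.\<close>
    have sub: "X - F \<subseteq> A n \<union> (\<Union>i. R (i + n))"
    proof
      fix x assume x: "x \<in> X - F"
      then have pos: "0 < infdist x F"
        using in_closed_iff_infdist_zero[OF assms F] infdist_nonneg[of x F] by (auto simp: less_le)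
      have ex: "\<exists>k. 1 / (real k + 1) \<le> infdist x F"
        using reals_Archimedean[OF pos] by (metis inverse_eq_divide less_imp_le of_nat_Suc add.commute)
      define k where "k = (LEAST k. 1 / (real k + 1) \<le> infdist x F)"
      have k: "1 / (real k + 1) \<le> infdist x F" unfolding k_def using ex by (rule LeastI_ex)
      show "x \<in> A n \<union> (\<Union>i. R (i + n))"
      proof (cases "k \<le> n")
        case True
        have "1 / (real n + 1) \<le> 1 / (real k + 1)" using True by (simp add: field_simps)
        with k x show ?thesis by (auto simp: A_def)
      next
        case False
        then obtain i where i: "k = Suc (i + n)" by (metis add.commute less_natE not_le)
        have "\<not> 1 / (real (i + n) + 1) \<le> infdist x F"
          using not_less_Least[of "i + n" "\<lambda>k. 1 / (real k + 1) \<le> infdist x F"] i k_def by auto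
        then have "x \<in> R (i + n)" using k x i by (auto simp: R_def add_ac)
        then show ?thesis by blast
      qed
    qed
    have "P (X - F) \<le> P (A n \<union> (\<Union>i. R (i + n)))" by (rule mono[OF sub])
    also have "\<dots> \<le> P (A n) + P (\<Union>i. R (i + n))" by (rule subadditive)
    also have "P (\<Union>i. R (i + n)) \<le> (\<Sum>i. ennreal (r (i + n)))"
      using countably_subadditive[of "\<lambda>i. R (i + n)"] by (simp add: r)
    also have "\<dots> = ennreal (\<Sum>i. r (i + n))"
      using r0 rs by (intro suminf_ennreal2) (auto simp: summable_iff_shift)
    also have "\<dots> \<le> ennreal e" using n by (intro ennreal_leI) auto
    finally have "P (X - F) \<le> P (A n) + ennreal e" by (simp add: add_left_mono)
    then have "P (X \<inter> F) + P (X - F) \<le> P (X \<inter> F) + P (A n) + ennreal e"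
      by (metis add.assoc add_left_mono)
    also have "\<dots> \<le> P X + ennreal e" by (intro add_right_mono A_le)
    finally show ?thesis .
  qed
  then show ?thesis by (rule ennreal_le_epsilon)
qed

section \<open>Measurability of Borel sets and the restricted measure\<close>

lemma outer_measure_space: "outer_measure_space UNIV P"
  using countably_subadditive
  by (auto simp: outer_measure_space_def positive_def increasing_def countably_subadditive_def mono)

lemma measure_space_lambda_system: "measure_space UNIV (lambda_system UNIV UNIV P) P"
  using sigma_algebra.caratheodory_lemma[OF sigma_algebra_Pow, of UNIV P] outer_measure_space by simp

text \<open>Closed sets generate the Borel sets, and for them the splitting condition is
  \<open>closed_caratheodory\<close> combined with subadditivity.\<close>

lemma borel_subset_lambda_system: "sets borel \<subseteq> lambda_system UNIV UNIV P"
proof -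
  have sa: "sigma_algebra UNIV (lambda_system UNIV UNIV P)"
    using measure_space_lambda_system by (simp add: measure_space_def)
  have "F \<in> lambda_system UNIV UNIV P" if "closed F" for F
  proof -
    have "P (F \<inter> X) + P (- F \<inter> X) = P X" for X
    proof -
      have "F \<inter> X = X \<inter> F" "- F \<inter> X = X - F" by auto
      with closed_caratheodory[OF that, of X] subadditive[of "X \<inter> F" "X - F"]
      show ?thesis unfolding Int_Diff_Un by (simp only: antisym)
    qed
    then show ?thesis by (simp add: lambda_system_def flip: Compl_eq_Diff_UNIV)
  qed
  then show ?thesis
    unfolding borel_eq_closed using sigma_algebra.sigma_sets_subset[OF sa, of "Collect closed"] by auto
qed

text \<open>Turns \<open>P\<close> into a genuine measure, which makes integration and continuity
  from below available on Borel sets.\<close>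

definition borel_measure :: "'a measure" where
  "borel_measure = measure_of UNIV (sets borel) P"

lemma space_borel_measure [simp]: "space borel_measure = UNIV"
  by (simp add: borel_measure_def)

lemma sets_borel_measure [simp, measurable_cong]: "sets borel_measure = sets borel"
  using sets.sets_measure_of_eq[of borel] by (simp add: borel_measure_def)

lemma emeasure_borel_measure [simp]: "A \<in> sets borel \<Longrightarrow> emeasure borel_measure A = P A"
proof -
  have "measure_space UNIV (sets borel) P"
    using measure_down[OF measure_space_lambda_system _ borel_subset_lambda_system] sets.sigma_algebra_axioms[of borel]
    by simp
  then show "A \<in> sets borel \<Longrightarrow> emeasure borel_measure A = P A"
    unfolding borel_measure_def by (intro emeasure_measure_of_sigma) (auto simp: measure_space_def)
qed

text \<open>A continuity from below for an arbitrary \<open>E\<close>, measurable or not: the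
  disjoint differences of balls are Borel, so \<open>P\<close> is additive on the traces of
  \<open>E\<close> on finitely many of them.\<close>

lemma le_if_bounded_parts_le:
  assumes "\<And>k::nat. P (E \<inter> cball a (real k)) \<le> M"
  shows "P E \<le> M"
proof -
  interpret UNIV: algebra UNIV "UNIV :: 'a set set" by (rule algebra_Pow[of UNIV, simplified])
  define A where "A = disjointed (\<lambda>k. cball a (real k))"
  have A: "range A \<subseteq> sets borel"
    unfolding A_def by (rule sets.range_disjointed_sets) auto
  have "(\<Union>i. E \<inter> A i) = E"
  proof -
    have "(\<Union>i. A i) = UNIV"
      unfolding A_def UN_disjointed_eq by (auto simp: real_arch_simple)
    then show ?thesis by auto
  qed
  then have "P E \<le> (\<Sum>i. P (E \<inter> A i))"
    using countably_subadditive[of "\<lambda>i. E \<inter> A i"] by simp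
  also have "\<dots> \<le> M"
  proof (intro suminf_le_const summableI)
    fix n
    have "(\<Sum>i<n. P (E \<inter> A i)) = P (E \<inter> (\<Union>i<n. A i))"
      using UNIV.lambda_system_strong_sum[of P E A n] A borel_subset_lambda_system
      by (auto simp: positive_def A_def disjoint_family_disjointed atLeast0LessThan)
    also have "\<dots> \<le> P (E \<inter> cball a (real n))"
      by (intro mono) (fastforce simp: A_def disjointed_def)
    also have "\<dots> \<le> M" by fact
    finally show "(\<Sum>i<n. P (E \<inter> A i)) \<le> M" .
  qed
  finally show ?thesis .
qed

end

section \<open>Premeasures over countable covers and the outer measures they generate\<close>

definition premeasure :: "'a set set \<Rightarrow> ('a set \<Rightarrow> ennreal) \<Rightarrow> 'a set \<Rightarrow> ennreal" where
  "premeasure \<C> \<zeta> E = (INF C \<in> {C :: nat \<Rightarrow> 'a set. (\<forall>i. C i \<in> \<C>) \<and> E \<subseteq> (\<Union>i. C i)}. \<Sum>i. \<zeta> (C i))"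

lemma premeasure_le: "(\<And>i. C i \<in> \<C>) \<Longrightarrow> E \<subseteq> (\<Union>i::nat. C i) \<Longrightarrow> premeasure \<C> \<zeta> E \<le> (\<Sum>i. \<zeta> (C i))"
  unfolding premeasure_def by (rule INF_lower) auto

lemma premeasure_less_cover:
  assumes "premeasure \<C> \<zeta> E < M"
  obtains C :: "nat \<Rightarrow> 'a set" where "\<And>i. C i \<in> \<C>" "E \<subseteq> (\<Union>i. C i)" "(\<Sum>i. \<zeta> (C i)) < M"
  using assms unfolding premeasure_def INF_less_iff by blast

lemma premeasure_mono: "E \<subseteq> E' \<Longrightarrow> premeasure \<C> \<zeta> E \<le> premeasure \<C> \<zeta> E'"
  unfolding premeasure_def by (rule INF_superset_mono) auto

lemma premeasure_antimono: "\<C> \<subseteq> \<C>' \<Longrightarrow> premeasure \<C>' \<zeta> E \<le> premeasure \<C> \<zeta> E"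
  unfolding premeasure_def by (rule INF_superset_mono) auto

text \<open>Covers of the \<open>E i\<close> that are optimal up to \<open>e / 2 ^ (i + 1)\<close>
  are merged into a single sequence by \<open>prod_decode\<close>.\<close>

lemma premeasure_countably_subadditive:
  "premeasure \<C> \<zeta> (\<Union>i::nat. E i) \<le> (\<Sum>i. premeasure \<C> \<zeta> (E i))"
proof (rule ennreal_le_epsilon)
  fix e :: real assume e: "0 < e" and fin: "(\<Sum>i. premeasure \<C> \<zeta> (E i)) < top"
  have "\<exists>C. (\<forall>k. C k \<in> \<C>) \<and> E i \<subseteq> (\<Union>k::nat. C k) \<and>
      (\<Sum>k. \<zeta> (C k)) \<le> premeasure \<C> \<zeta> (E i) + ennreal (e * (1/2) ^ Suc i)" for i
  proof -
    have "premeasure \<C> \<zeta> (E i) < top" using fin by (rule ennreal_suminf_lessD)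
    moreover have "0 < ennreal (e * (1/2) ^ Suc i)" using e by simp
    ultimately have "premeasure \<C> \<zeta> (E i) < premeasure \<C> \<zeta> (E i) + ennreal (e * (1/2) ^ Suc i)"
      by (cases "premeasure \<C> \<zeta> (E i)") (auto simp flip: ennreal_plus simp: e ennreal_lessI)
    then show ?thesis by (rule premeasure_less_cover) (blast intro: less_imp_le)
  qed
  then obtain C where C: "\<And>i k. C i k \<in> \<C>" "\<And>i. E i \<subseteq> (\<Union>k::nat. C i k)"
      "\<And>i. (\<Sum>k. \<zeta> (C i k)) \<le> premeasure \<C> \<zeta> (E i) + ennreal (e * (1/2) ^ Suc i)"
    by metis
  define D where "D = (\<lambda>(i, k). C i k) \<circ> prod_decode"
  have "(\<Union>i. E i) \<subseteq> (\<Union>n. D n)"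
  proof
    fix x assume "x \<in> (\<Union>i. E i)"
    then obtain i k where "x \<in> C i k" using C(2) by blast
    then have "x \<in> D (prod_encode (i, k))" by (simp add: D_def)
    then show "x \<in> (\<Union>n. D n)" by blast
  qed
  moreover have "D n \<in> \<C>" for n using C(1) by (auto simp: D_def split: prod.split)
  ultimately have "premeasure \<C> \<zeta> (\<Union>i. E i) \<le> (\<Sum>n. \<zeta> (D n))" by (intro premeasure_le)
  also have "\<dots> = (\<Sum>n. (\<lambda>(i, k). \<zeta> (C i k)) (prod_decode n))"
    by (simp add: D_def case_prod_beta)
  also have "\<dots> = (\<Sum>i. \<Sum>k. \<zeta> (C i k))" by (rule suminf_ennreal_2dimen) simp
  also have "\<dots> \<le> (\<Sum>i. premeasure \<C> \<zeta> (E i) + ennreal (e * (1/2) ^ Suc i))"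
    by (intro suminf_le summableI C)
  also have "\<dots> = (\<Sum>i. premeasure \<C> \<zeta> (E i)) + (\<Sum>i. ennreal (e * (1/2) ^ Suc i))"
    by (intro suminf_add[symmetric] summableI)
  also have "(\<Sum>i. ennreal (e * (1/2) ^ Suc i)) = ennreal e"
    using e sums_mult[OF power_half_series, of e] by (intro suminf_ennreal_eq) auto
  finally show "premeasure \<C> \<zeta> (\<Union>i. E i) \<le> (\<Sum>i. premeasure \<C> \<zeta> (E i)) + ennreal e" .
qed

text \<open>The data for Caratheodory's construction from fine covers. The classes shrink with
  \<open>\<delta>\<close>, so the premeasures grow as \<open>\<delta>\<close> decreases; the empty
  set, at cost 0, pads covers to sequences; \<open>dist_le\<close> makes the limit a metric outer
  measure.\<close>

locale gauge_family =
  fixes \<C> :: "real \<Rightarrow> 'a::metric_space set set" and \<zeta> :: "'a set \<Rightarrow> ennreal"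
  assumes empty_mem: "0 < \<delta> \<Longrightarrow> {} \<in> \<C> \<delta>"
    and gauge_empty: "\<zeta> {} = 0"
    and family_mono: "\<delta> \<le> \<delta>' \<Longrightarrow> \<C> \<delta> \<subseteq> \<C> \<delta>'"
    and dist_le: "S \<in> \<C> \<delta> \<Longrightarrow> x \<in> S \<Longrightarrow> y \<in> S \<Longrightarrow> dist x y \<le> \<delta>"
begin

definition outer :: "'a set \<Rightarrow> ennreal" where
  "outer E = (SUP \<delta>\<in>{0<..}. premeasure (\<C> \<delta>) \<zeta> E)"

lemma premeasure_le_outer: "0 < \<delta> \<Longrightarrow> premeasure (\<C> \<delta>) \<zeta> E \<le> outer E"
  unfolding outer_def by (rule SUP_upper) auto

lemma outer_le: "(\<And>\<delta>. 0 < \<delta> \<Longrightarrow> premeasure (\<C> \<delta>) \<zeta> E \<le> M) \<Longrightarrow> outer E \<le> M"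
  unfolding outer_def by (rule SUP_least) auto

lemma less_outerE:
  assumes "M < outer E"
  obtains \<delta>\<^sub>0 where "0 < \<delta>\<^sub>0" "\<And>\<delta>. 0 < \<delta> \<Longrightarrow> \<delta> \<le> \<delta>\<^sub>0 \<Longrightarrow> M < premeasure (\<C> \<delta>) \<zeta> E"
proof -
  obtain \<delta>\<^sub>0 where "0 < \<delta>\<^sub>0" "M < premeasure (\<C> \<delta>\<^sub>0) \<zeta> E"
    using assms unfolding outer_def less_SUP_iff by auto
  then show thesis
    using that[of \<delta>\<^sub>0] premeasure_antimono[OF family_mono] by (meson less_le_trans)
qed

sublocale metric_outer_measure outer
proof
  show "outer {} = 0"
  proof -
    have "premeasure (\<C> \<delta>) \<zeta> {} = 0" if "0 < \<delta>" for \<delta>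
      using premeasure_le[of "\<lambda>_. {}" "\<C> \<delta>" "{}" \<zeta>] empty_mem[OF that] by (simp add: gauge_empty)
    then have "outer {} \<le> 0" by (intro outer_le) simp
    then show ?thesis by simp
  qed
  show "outer A \<le> outer B" if "A \<subseteq> B" for A B
    using premeasure_mono[OF that] premeasure_le_outer by (intro outer_le) (blast intro: order_trans)
  show "outer (\<Union>i. A' i) \<le> (\<Sum>i. outer (A' i))" for A' :: "nat \<Rightarrow> 'a set"
  proof (rule outer_le)
    fix \<delta> :: real assume "0 < \<delta>"
    have "premeasure (\<C> \<delta>) \<zeta> (\<Union>i. A' i) \<le> (\<Sum>i. premeasure (\<C> \<delta>) \<zeta> (A' i))"
      by (rule premeasure_countably_subadditive)
    also have "\<dots> \<le> (\<Sum>i. outer (A' i))"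
      using \<open>0 < \<delta>\<close> by (intro suminf_le summableI premeasure_le_outer)
    finally show "premeasure (\<C> \<delta>) \<zeta> (\<Union>i. A' i) \<le> (\<Sum>i. outer (A' i))" .
  qed
  show "outer A + outer B \<le> outer (A \<union> B)"
    if r: "0 < r" and sep: "\<And>x y. x \<in> A \<Longrightarrow> y \<in> B \<Longrightarrow> r \<le> dist x y" for A B and r :: real
  proof -
    \<comment> \<open>At a scale below \<open>r\<close> no member of a cover meets both
      \<open>A\<close> and \<open>B\<close>, so every cover of the union splits into a cover of
      \<open>A\<close> and a cover of \<open>B\<close>.\<close>
    have main: "premeasure (\<C> \<delta>) \<zeta> A + premeasure (\<C> \<delta>) \<zeta> B \<le> premeasure (\<C> \<delta>) \<zeta> (A \<union> B)"
      if \<delta>: "0 < \<delta>" "\<delta> < r" for \<delta>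
    proof -
      have "premeasure (\<C> \<delta>) \<zeta> A + premeasure (\<C> \<delta>) \<zeta> B \<le> (\<Sum>i. \<zeta> (C i))"
        if C: "\<And>i. C i \<in> \<C> \<delta>" "A \<union> B \<subseteq> (\<Union>i::nat. C i)" for C
      proof -
        define C1 where "C1 i = (if C i \<inter> A = {} then {} else C i)" for i
        define C2 where "C2 i = (if C i \<inter> A = {} then C i else {})" for i
        have 1: "premeasure (\<C> \<delta>) \<zeta> A \<le> (\<Sum>i. \<zeta> (C1 i))"
          using C empty_mem \<delta> by (intro premeasure_le) (fastforce simp: C1_def)+
        have "B \<subseteq> (\<Union>i. C2 i)"
        proof
          fix y assume y: "y \<in> B"
          then obtain i where i: "y \<in> C i" using C(2) by auto
          have "C i \<inter> A = {}"
          proof (rule ccontr)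
            assume "C i \<inter> A \<noteq> {}"
            then obtain x where x: "x \<in> C i" "x \<in> A" by blast
            then show False using dist_le[OF C(1) x(1) i] sep[OF x(2) y] \<delta> by auto
          qed
          then show "y \<in> (\<Union>i. C2 i)" using i by (auto simp: C2_def)
        qed
        then have 2: "premeasure (\<C> \<delta>) \<zeta> B \<le> (\<Sum>i. \<zeta> (C2 i))"
          using C empty_mem \<delta> by (intro premeasure_le) (auto simp: C2_def)
        have "(\<Sum>i. \<zeta> (C1 i)) + (\<Sum>i. \<zeta> (C2 i)) = (\<Sum>i. \<zeta> (C1 i) + \<zeta> (C2 i))"
          by (intro suminf_add summableI)
        also have "\<dots> = (\<Sum>i. \<zeta> (C i))"
          by (intro suminf_cong) (simp add: C1_def C2_def gauge_empty)
        finally show ?thesis using add_mono[OF 1 2] by simp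
      qed
      then show ?thesis unfolding premeasure_def[of _ _ "A \<union> B"] by (intro INF_greatest) auto
    qed
    show ?thesis
    proof (rule ccontr)
      assume "\<not> ?thesis"
      then have lt: "outer (A \<union> B) < outer A + outer B" by simp
      have "outer A + outer B = (SUP \<delta>\<in>{0<..}. premeasure (\<C> \<delta>) \<zeta> A + outer B)"
        unfolding outer_def[of A] by (subst ennreal_SUP_add_left) auto
      with lt obtain \<delta>1 where \<delta>1: "0 < \<delta>1" "outer (A \<union> B) < premeasure (\<C> \<delta>1) \<zeta> A + outer B"
        by (auto simp: less_SUP_iff)
      have "premeasure (\<C> \<delta>1) \<zeta> A + outer B = (SUP \<delta>\<in>{0<..}. premeasure (\<C> \<delta>1) \<zeta> A + premeasure (\<C> \<delta>) \<zeta> B)"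
        unfolding outer_def by (subst ennreal_SUP_add_right) auto
      with \<delta>1 obtain \<delta>2 where \<delta>2: "0 < \<delta>2" "outer (A \<union> B) < premeasure (\<C> \<delta>1) \<zeta> A + premeasure (\<C> \<delta>2) \<zeta> B"
        by (auto simp: less_SUP_iff)
      \<comment> \<open>The two suprema were approximated at different scales. The minimum serves
        both, by monotonicity, and \<open>r / 2\<close> keeps it strictly below \<open>r\<close> as
        \<open>main\<close> requires.\<close>
      define \<delta> where "\<delta> = min (r / 2) (min \<delta>1 \<delta>2)"
      have \<delta>: "0 < \<delta>" "\<delta> < r" "\<delta> \<le> \<delta>1" "\<delta> \<le> \<delta>2" using r \<delta>1 \<delta>2 by (auto simp: \<delta>_def)
      have "premeasure (\<C> \<delta>1) \<zeta> A + premeasure (\<C> \<delta>2) \<zeta> B \<le> premeasure (\<C> \<delta>) \<zeta> A + premeasure (\<C> \<delta>) \<zeta> B"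
        using \<delta> by (intro add_mono premeasure_antimono family_mono)
      also have "\<dots> \<le> premeasure (\<C> \<delta>) \<zeta> (A \<union> B)" using \<delta> by (intro main)
      also have "\<dots> \<le> outer (A \<union> B)" using \<delta> by (intro premeasure_le_outer)
      finally show False using \<delta>2(2) by simp
    qed
  qed
qed

end

section \<open>Hausdorff content and weighted covers\<close>

context gauge_family
begin

text \<open>Lets a subfamily, such as a Vitali selection, act as a cover without renumbering:
  indices outside \<open>J\<close> are filled with the empty set.\<close>

lemma premeasure_le_indexed:
  fixes J :: "nat set"
  assumes "0 < \<delta>" "\<And>i. i \<in> J \<Longrightarrow> C i \<in> \<C> \<delta>" "E \<subseteq> (\<Union>i\<in>J. C i)"
  shows "premeasure (\<C> \<delta>) \<zeta> E \<le> (\<Sum>i. \<zeta> (C i) * indicator J i)"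
proof -
  have "premeasure (\<C> \<delta>) \<zeta> E \<le> (\<Sum>i. \<zeta> (if i \<in> J then C i else {}))"
    using assms empty_mem[OF assms(1)] by (intro premeasure_le) (auto split: if_splits)
  also have "(\<lambda>i. \<zeta> (if i \<in> J then C i else {})) = (\<lambda>i. \<zeta> (C i) * indicator J i)"
    by (auto simp: gauge_empty)
  finally show ?thesis .
qed

lemma premeasure_subadditive:
  assumes "0 < \<delta>"
  shows "premeasure (\<C> \<delta>) \<zeta> (A \<union> B) \<le> premeasure (\<C> \<delta>) \<zeta> A + premeasure (\<C> \<delta>) \<zeta> B"
proof -
  define A' where "A' = (\<lambda>i::nat. if i = 0 then A else if i = 1 then B else {})"
  have "A \<union> B = (\<Union>i. A' i)"
    by (auto simp: A'_def split: if_splits)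
  then have "premeasure (\<C> \<delta>) \<zeta> (A \<union> B) \<le> (\<Sum>i. premeasure (\<C> \<delta>) \<zeta> (A' i))"
    using premeasure_countably_subadditive[of "\<C> \<delta>" \<zeta> A'] by simp
  also have "\<dots> = (\<Sum>i\<in>{0,1}. premeasure (\<C> \<delta>) \<zeta> (A' i))"
    using premeasure_le_outer[OF assms, of "{}"] by (intro suminf_finite) (auto simp: A'_def)
  finally show ?thesis by (simp add: A'_def)
qed

end

definition small_sets :: "real \<Rightarrow> 'a::metric_space set set" where
  "small_sets \<delta> = {S. bounded S \<and> diameter S \<le> \<delta>}"

text \<open>The empty set has cost 0 for every real \<open>q\<close>, because
  \<open>0 powr q = 0\<close>.\<close>

lemma gauge_family_small_sets:
  "gauge_family (small_sets :: real \<Rightarrow> 'a::metric_space set set) (\<lambda>S. ennreal (diameter S powr q))"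
  by unfold_locales (auto simp: small_sets_def dest: diameter_bounded_bound)

interpretation hausdorff: gauge_family "small_sets :: real \<Rightarrow> 'a::metric_space set set" "\<lambda>S. ennreal (diameter S powr q)"
  rewrites "gauge_family.outer (small_sets :: real \<Rightarrow> 'a::metric_space set set) (\<lambda>S. ennreal (diameter S powr q)) = hausdorff_outer q"
  for q :: real
proof -
  show "gauge_family (small_sets :: real \<Rightarrow> 'a::metric_space set set) (\<lambda>S. ennreal (diameter S powr q))"
    by (rule gauge_family_small_sets)
  then interpret gauge_family "small_sets :: real \<Rightarrow> 'a::metric_space set set" "\<lambda>S. ennreal (diameter S powr q)" .
  show "outer = hausdorff_outer q"
    by (simp add: fun_eq_iff outer_def hausdorff_outer_def premeasure_def small_sets_def)
qed

abbreviation hausdorff_content :: "real \<Rightarrow> real \<Rightarrow> 'a::metric_space set \<Rightarrow> ennreal" where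
  "hausdorff_content q \<delta> \<equiv> premeasure (small_sets \<delta>) (\<lambda>S. ennreal (diameter S powr q))"

lemma hausdorff_outer_diameter_zero:
  assumes "bounded S" "diameter S = 0"
  shows "hausdorff_outer q S = 0"
proof -
  have "hausdorff_content q \<delta> S \<le> (\<Sum>i::nat. ennreal (diameter S powr q))" if "0 < \<delta>" for \<delta>
    using that assms by (intro premeasure_le) (auto simp: small_sets_def)
  then have "hausdorff_outer q S \<le> 0" using assms by (intro hausdorff.outer_le) simp
  then show ?thesis by simp
qed

section \<open>Vitali selection and finite weighted covers\<close>

definition enlarge :: "'a::euclidean_space set \<Rightarrow> 'a set" where
  "enlarge S = cball (SOME x. x \<in> S) (5 * diameter S)"

lemma closed_enlarge: "closed (enlarge S)"
  by (simp add: enlarge_def)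

lemma bounded_enlarge: "bounded (enlarge S)"
  by (simp add: enlarge_def)

lemma diameter_enlarge: "bounded S \<Longrightarrow> diameter (enlarge S) = 10 * diameter S"
  using diameter_ge_0[of S] by (simp add: enlarge_def)

text \<open>The Vitali covering lemma is applied to balls centred at a chosen point of
  \<open>S i\<close> with radius \<open>diameter (S i)\<close>. Such a ball contains
  \<open>S i\<close>, so disjoint balls give disjoint sets, and the fivefold balls are the sets
  \<open>enlarge (S i)\<close>.\<close>

lemma vitali_sets:
  fixes S :: "'i \<Rightarrow> 'a::euclidean_space set"
  assumes S: "\<And>i. i \<in> I \<Longrightarrow> bounded (S i) \<and> 0 < diameter (S i) \<and> diameter (S i) \<le> \<delta>"
  obtains J where "J \<subseteq> I" "disjoint_family_on S J" "(\<Union>i\<in>I. S i) \<subseteq> (\<Union>i\<in>J. enlarge (S i))"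
proof -
  define a where "a i = (SOME x. x \<in> S i)" for i
  have sub: "S i \<subseteq> cball (a i) (diameter (S i))" if "i \<in> I" for i
  proof
    fix y assume y: "y \<in> S i"
    then have "a i \<in> S i" unfolding a_def by (rule someI)
    with y S[OF that] show "y \<in> cball (a i) (diameter (S i))"
      using diameter_bounded_bound[of "S i" "a i" y] by simp
  qed
  obtain J where J: "J \<subseteq> I"
      "pairwise (\<lambda>i j. disjnt (cball (a i) (diameter (S i))) (cball (a j) (diameter (S j)))) J"
      "(\<Union>i\<in>I. S i) \<subseteq> (\<Union>i\<in>J. cball (a i) (5 * diameter (S i)))"
    using Vitali_covering_lemma_cballs[where S = "\<Union>i\<in>I. S i" and K = I and a = a and r = "\<lambda>i. diameter (S i)" and B = \<delta>] sub S
    by (metis (no_types, lifting) UN_mono subset_refl)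
  have "disjoint_family_on S J"
    using J(1,2) sub unfolding disjoint_family_on_def pairwise_def disjnt_def by blast
  with J show thesis by (intro that) (auto simp: enlarge_def a_def)
qed

text \<open>Subtracting the smallest weight of a disjoint subfamily from all of its members lowers the
  total weight at each point by at most that amount and removes at least one set.\<close>
lemma weighted_cover_bound:
  fixes S :: "'i \<Rightarrow> 'a set" and b :: "'i \<Rightarrow> real"
  assumes "finite I" and b: "\<And>i. i \<in> I \<Longrightarrow> 0 \<le> b i" and "0 \<le> \<kappa>"
    and disjoint: "\<And>I'. I' \<subseteq> I \<Longrightarrow> K \<subseteq> (\<Union>i\<in>I'. S i) \<Longrightarrow> \<exists>J\<subseteq>I'. disjoint_family_on S J \<and> \<kappa> \<le> sum b J"
    and "0 \<le> \<theta>" "\<And>i. i \<in> I \<Longrightarrow> 0 \<le> c i"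
    and "\<And>y. y \<in> K \<Longrightarrow> \<theta> \<le> (\<Sum>i\<in>I. c i * indicator (S i) y)"
  shows "\<theta> * \<kappa> \<le> (\<Sum>i\<in>I. c i * b i)"
  using assms(5-7)
proof (induction "card {i \<in> I. 0 < c i}" arbitrary: c \<theta> rule: less_induct)
  case less
  have nonneg: "0 \<le> (\<Sum>i\<in>I. c i * b i)" using less.prems b by (intro sum_nonneg mult_nonneg_nonneg)
  show ?case
  proof (cases "\<theta> = 0 \<or> \<kappa> = 0")
    case True
    then show ?thesis using nonneg by auto
  next
    case False
    then have pos: "0 < \<theta>" "0 < \<kappa>" using less.prems \<open>0 \<le> \<kappa>\<close> by auto
    have "K \<subseteq> (\<Union>i\<in>{i \<in> I. 0 < c i}. S i)"
    proof (rule ccontr)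
      assume "\<not> ?thesis"
      then obtain y where y: "y \<in> K" "\<And>i. i \<in> I \<Longrightarrow> 0 < c i \<Longrightarrow> y \<notin> S i" by auto
      have "c i * indicator (S i) y = 0" if "i \<in> I" for i
        using y(2)[OF that] less.prems(2)[OF that] by (cases "c i = 0") auto
      then have "(\<Sum>i\<in>I. c i * indicator (S i) y) = 0" by (intro sum.neutral ballI)
      then show False using less.prems(3)[OF y(1)] pos by simp
    qed
    then obtain J where J: "J \<subseteq> {i \<in> I. 0 < c i}" "disjoint_family_on S J" "\<kappa> \<le> sum b J"
      using disjoint[of "{i \<in> I. 0 < c i}"] by auto
    have finJ: "finite J" using finite_subset[OF J(1)] \<open>finite I\<close> by simp
    have JI: "J \<subseteq> I" using J(1) by auto
    have "J \<noteq> {}" using J(3) pos by auto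
    then obtain m where m: "m \<in> J" "\<And>i. i \<in> J \<Longrightarrow> c m \<le> c i"
      using finJ by (metis arg_min_if_finite(1) arg_min_least)
    \<comment> \<open>The cap at \<open>\<theta>\<close> keeps \<open>\<theta> - \<tau>\<close>
      nonnegative. If the cap is attained the remaining bound is trivial; otherwise the weight of
      \<open>m\<close> drops to 0 and the induction hypothesis applies.\<close>
    define \<tau> where "\<tau> = min \<theta> (c m)"
    have \<tau>: "0 < \<tau>" "\<tau> \<le> \<theta>" "\<And>i. i \<in> J \<Longrightarrow> \<tau> \<le> c i"
      using pos m J(1) by (force simp: \<tau>_def)+
    define c' where "c' i = c i - (if i \<in> J then \<tau> else 0)" for i
    have split: "(\<Sum>i\<in>I. c' i * w i) = (\<Sum>i\<in>I. c i * w i) - \<tau> * sum w J" for w :: "'i \<Rightarrow> real"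
    proof -
      have "(\<Sum>i\<in>I. c' i * w i) = (\<Sum>i\<in>I. c i * w i) - (\<Sum>i\<in>I. if i \<in> J then \<tau> * w i else 0)"
        unfolding sum_subtractf[symmetric] by (intro sum.cong) (auto simp: c'_def algebra_simps)
      also have "(\<Sum>i\<in>I. if i \<in> J then \<tau> * w i else 0) = \<tau> * sum w J"
        using JI \<open>finite I\<close> by (simp add: sum.inter_restrict[symmetric] Int_absorb1 sum_distrib_left)
      finally show ?thesis .
    qed
    have c': "0 \<le> c' i" if "i \<in> I" for i
      using less.prems(2)[OF that] \<tau>(3) by (auto simp: c'_def)
    have "(\<theta> - \<tau>) * \<kappa> \<le> (\<Sum>i\<in>I. c' i * b i)"
    proof (cases "\<tau> = \<theta>")
      case True
      then show ?thesis using c' b by (auto intro!: sum_nonneg)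
    next
      case False
      then have "c' m = 0" using m(1) by (auto simp: c'_def \<tau>_def)
      moreover have "{i \<in> I. 0 < c' i} \<subseteq> {i \<in> I. 0 < c i}"
        using \<tau>(1) by (auto simp: c'_def split: if_splits)
      moreover have "m \<in> {i \<in> I. 0 < c i}" using m(1) J(1) by auto
      ultimately have "{i \<in> I. 0 < c' i} \<subset> {i \<in> I. 0 < c i}" by force
      then have "card {i \<in> I. 0 < c' i} < card {i \<in> I. 0 < c i}"
        using \<open>finite I\<close> by (intro psubset_card_mono) auto
      then show ?thesis
      proof (rule less.hyps)
        show "0 \<le> \<theta> - \<tau>" using \<tau> by simp
        show "0 \<le> c' i" if "i \<in> I" for i using c' that .
        show "\<theta> - \<tau> \<le> (\<Sum>i\<in>I. c' i * indicator (S i) y)" if "y \<in> K" for y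
        proof -
          have "(\<Sum>i\<in>J. indicator (S i) y) \<le> (1::real)"
          proof (cases "\<exists>i\<in>J. y \<in> S i")
            case True
            then obtain k where k: "k \<in> J" "y \<in> S k" by auto
            have "(\<Sum>i\<in>J. indicator (S i) y) = (\<Sum>i\<in>J. if i = k then 1 else (0::real))"
              using k J(2) by (intro sum.cong) (auto simp: disjoint_family_on_def indicator_def)
            then show ?thesis using finJ k by simp
          qed (simp add: indicator_def)
          then have "\<tau> * (\<Sum>i\<in>J. indicator (S i) y) \<le> \<tau>" using \<tau>(1) by simp
          then show ?thesis using less.prems(3)[OF that] unfolding split by simp
        qed
      qed
    qed
    moreover have "\<tau> * \<kappa> \<le> \<tau> * sum b J" using J(3) \<tau>(1) by simp
    ultimately show ?thesis unfolding split by (simp add: algebra_simps)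
  qed
qed

text \<open>Any subfamily covering \<open>K\<close> contains a disjoint Vitali subfamily whose
  enlargements cover \<open>K\<close> at scale \<open>10 * \<delta>\<close>, so its cost times
  \<open>10 powr q\<close> is at least the content of \<open>K\<close>. This is the hypothesis of
  \<open>weighted_cover_bound\<close> with the content as \<open>\<kappa>\<close>.\<close>

lemma content_weighted_bound:
  fixes S :: "nat \<Rightarrow> 'a::euclidean_space set"
  assumes "finite I" "0 < \<delta>" "0 < \<theta>"
    and S: "\<And>i. i \<in> I \<Longrightarrow> bounded (S i) \<and> 0 < diameter (S i) \<and> diameter (S i) \<le> \<delta>"
    and c: "\<And>i. i \<in> I \<Longrightarrow> 0 \<le> c i"
    and K: "\<And>y. y \<in> K \<Longrightarrow> \<theta> \<le> (\<Sum>i\<in>I. c i * indicator (S i) y)"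
  shows "hausdorff_content q (10 * \<delta>) K \<le> ennreal (10 powr q * (\<Sum>i\<in>I. c i * diameter (S i) powr q) / \<theta>)"
proof -
  have cover: "\<exists>J\<subseteq>I'. disjoint_family_on S J \<and>
      hausdorff_content q (10 * \<delta>) K \<le> ennreal (10 powr q * (\<Sum>i\<in>J. diameter (S i) powr q))"
    if I': "I' \<subseteq> I" "K \<subseteq> (\<Union>i\<in>I'. S i)" for I'
  proof -
    obtain J where J: "J \<subseteq> I'" "disjoint_family_on S J" "(\<Union>i\<in>I'. S i) \<subseteq> (\<Union>i\<in>J. enlarge (S i))"
      using vitali_sets[of I' S \<delta>] S I'(1) by blast
    have finJ: "finite J" using finite_subset[of J I] J(1) I'(1) \<open>finite I\<close> by auto
    have "hausdorff_content q (10 * \<delta>) K \<le> (\<Sum>i. ennreal (diameter (enlarge (S i)) powr q) * indicator J i)"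
    proof (rule hausdorff.premeasure_le_indexed)
      show "enlarge (S i) \<in> small_sets (10 * \<delta>)" if "i \<in> J" for i
        using S[of i] that J(1) I'(1) by (auto simp: small_sets_def bounded_enlarge diameter_enlarge)
    qed (use \<open>0 < \<delta>\<close> I' J in auto)
    also have "\<dots> = (\<Sum>i\<in>J. ennreal (diameter (enlarge (S i)) powr q) * indicator J i)"
      using finJ by (intro suminf_finite) auto
    also have "\<dots> = (\<Sum>i\<in>J. ennreal (10 powr q * diameter (S i) powr q))"
    proof (intro sum.cong refl)
      fix i assume "i \<in> J"
      then have "bounded (S i)" "0 < diameter (S i)" using S J(1) I'(1) by auto
      then show "ennreal (diameter (enlarge (S i)) powr q) * indicator J i = ennreal (10 powr q * diameter (S i) powr q)"
        using \<open>i \<in> J\<close> by (simp add: diameter_enlarge powr_mult)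
    qed
    also have "\<dots> = ennreal (10 powr q * (\<Sum>i\<in>J. diameter (S i) powr q))"
      by (simp add: sum_ennreal sum_distrib_left)
    finally show ?thesis using J by blast
  qed
  have "K \<subseteq> (\<Union>i\<in>I. S i)"
  proof (rule ccontr)
    assume "\<not> ?thesis"
    then obtain y where y: "y \<in> K" "\<And>i. i \<in> I \<Longrightarrow> y \<notin> S i" by auto
    then have "(\<Sum>i\<in>I. c i * indicator (S i) y) = 0" by simp
    then show False using K[OF y(1)] \<open>0 < \<theta>\<close> by simp
  qed
  \<comment> \<open>\<open>weighted_cover_bound\<close> works with reals; the finite cover by the
    whole family shows that the content is a real number.\<close>
  then have "hausdorff_content q (10 * \<delta>) K < top"
    using cover[of I] by (auto intro: le_less_trans)
  then obtain \<kappa> where \<kappa>: "0 \<le> \<kappa>" "hausdorff_content q (10 * \<delta>) K = ennreal \<kappa>"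
    by (cases "hausdorff_content q (10 * \<delta>) K") auto
  have "\<theta> * \<kappa> \<le> (\<Sum>i\<in>I. c i * (10 powr q * diameter (S i) powr q))"
  proof (rule weighted_cover_bound)
    show "\<exists>J\<subseteq>I'. disjoint_family_on S J \<and> \<kappa> \<le> (\<Sum>i\<in>J. 10 powr q * diameter (S i) powr q)"
      if "I' \<subseteq> I" "K \<subseteq> (\<Union>i\<in>I'. S i)" for I'
      using cover[OF that] unfolding \<kappa> by (auto simp: sum_nonneg sum_distrib_left)
  qed (use assms \<kappa> in auto)
  also have "\<dots> = 10 powr q * (\<Sum>i\<in>I. c i * diameter (S i) powr q)"
    by (simp add: sum_distrib_left mult_ac)
  finally show ?thesis unfolding \<kappa> using \<open>0 < \<theta>\<close>
    by (intro ennreal_leI) (simp add: field_simps)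
qed

text \<open>A fractional cover: the weights of the sets containing a point of \<open>B\<close> add
  up to at least 1, and may add up to infinity. Closedness makes the sets Borel, for the later
  integration.\<close>

locale weighted_cover =
  fixes q \<delta> M :: real and S :: "nat \<Rightarrow> 'a::euclidean_space set" and c :: "nat \<Rightarrow> real" and B :: "'a set"
  assumes \<delta>_pos: "0 < \<delta>" and M_pos: "0 < M"
    and closed: "closed (S i)" and bounded: "bounded (S i)" and diameter_le: "diameter (S i) \<le> \<delta>"
    and nonneg: "0 \<le> c i"
    and covers: "y \<in> B \<Longrightarrow> 1 \<le> (\<Sum>i. ennreal (c i) * indicator (S i) y)"
    and cost_le: "(\<Sum>i. ennreal (c i * diameter (S i) powr q)) \<le> ennreal M"
begin

text \<open>The family is cut into finite blocks such that the cost beyond the j-th cut is at most M / 4^j.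
  At a point of B some block has weight at least 2^-(j+2), and the finite estimate applies to
  each block.\<close>
lemma content_le: "hausdorff_content q (10 * \<delta>) B \<le> ennreal (8 * 10 powr q * M)"
proof -
  define a where "a i = c i * diameter (S i) powr q" for i
  have a0: "0 \<le> a i" for i by (simp add: a_def nonneg)
  have a_fin: "(\<Sum>i. ennreal (a i)) \<noteq> top" using cost_le by (auto simp: a_def top_unique)
  then have as: "summable a" using a0 by (intro summable_suminf_not_top) auto
  have as_shift: "summable (\<lambda>i. a (i + n))" for n using as by (simp add: summable_iff_shift)
  have "ennreal (suminf a) \<le> ennreal M" using cost_le as a0 by (simp add: suminf_ennreal2 flip: a_def)
  then have aM: "suminf a \<le> M" using M_pos by (simp add: ennreal_le_iff2)
  have "\<exists>n0. \<forall>n\<ge>n0. norm (\<Sum>i. a (i + n)) < M * (1/4) ^ j" for j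
    using suminf_exist_split[OF _ as] M_pos by simp
  then obtain g where g: "\<And>j n. g j \<le> n \<Longrightarrow> norm (\<Sum>i. a (i + n)) < M * (1/4) ^ j" by metis
  \<comment> \<open>The cuts start at \<open>N 0 = 0\<close>, where the tail is the whole cost, at
    most \<open>M\<close>. The summand \<open>g (Suc k)\<close> pushes each later cut past the index
    required for the factor \<open>1 / 4 ^ j\<close>, and \<open>+ 1\<close> ensures
    \<open>j \<le> N j\<close>, so the blocks exhaust all indices.\<close>
  define N where "N j = (\<Sum>k<j. g (Suc k) + 1)" for j
  have N_Suc: "N (Suc j) = N j + g (Suc j) + 1" for j by (simp add: N_def)
  have N_mono: "N j \<le> N (Suc j)" for j by (simp add: N_Suc)
  have N_ge: "j \<le> N j" for j by (induction j) (auto simp: N_Suc)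
  have tail: "(\<Sum>i. a (i + N j)) \<le> M * (1/4) ^ j" for j
  proof (cases j)
    case 0
    then show ?thesis using aM by (simp add: N_def)
  next
    case (Suc k)
    then have "g j \<le> N j" by (simp add: N_Suc)
    then show ?thesis using g[of j "N j"] by simp
  qed
  have block: "(\<Sum>i\<in>{N j..<N (Suc j)}. a i) \<le> M * (1/4) ^ j" for j
  proof -
    have "(\<Sum>i\<in>{N j..<N (Suc j)}. a i) = (\<Sum>i<N (Suc j) - N j. a (i + N j))"
      using sum.shift_bounds_nat_ivl[of a 0 "N j" "N (Suc j) - N j"] N_mono[of j] by (simp add: atLeast0LessThan)
    also have "\<dots> \<le> (\<Sum>i. a (i + N j))" by (intro sum_le_suminf as_shift) (auto simp: a0)
    also have "\<dots> \<le> M * (1/4) ^ j" by (rule tail)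
    finally show ?thesis .
  qed
  define I where "I j = {i \<in> {N j..<N (Suc j)}. 0 < diameter (S i)}" for j
  define K where "K j = {y. (1/2) ^ (j + 2) \<le> (\<Sum>i\<in>I j. c i * indicator (S i) y)}" for j
  \<comment> \<open>Sets of diameter 0 may carry weight at no cost and are excluded from
    \<open>I j\<close>; their union has content 0 and is treated separately.\<close>
  define Z where "Z = (\<Union>i\<in>{i. diameter (S i) = 0}. S i)"
  \<comment> \<open>The thresholds \<open>(1/2) ^ (j + 2)\<close> add up to 1/2, so a point outside
    \<open>Z\<close> and all \<open>K j\<close> has total weight at most 1/2 and cannot lie in
    \<open>B\<close>.\<close>
  have "B \<subseteq> Z \<union> (\<Union>j. K j)"
  proof (rule ccontr)
    assume "\<not> ?thesis"
    then obtain y where y: "y \<in> B" "y \<notin> Z" "\<And>j. y \<notin> K j" by auto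
    have blk: "(\<Sum>i\<in>{N j..<N (Suc j)}. c i * indicator (S i) y) \<le> (1/2) ^ (j + 2)" for j
    proof -
      have "(\<Sum>i\<in>{N j..<N (Suc j)}. c i * indicator (S i) y) = (\<Sum>i\<in>I j. c i * indicator (S i) y)"
      proof (rule sum.mono_neutral_right)
        show "\<forall>i\<in>{N j..<N (Suc j)} - I j. c i * indicator (S i) y = 0"
        proof
          fix i assume "i \<in> {N j..<N (Suc j)} - I j"
          then have "diameter (S i) = 0" using diameter_ge_0[OF bounded, of i] by (auto simp: I_def)
          then show "c i * indicator (S i) y = 0" using y(2) by (auto simp: Z_def indicator_def)
        qed
      qed (auto simp: I_def)
      then show ?thesis using y(3)[of j] by (simp add: K_def)
    qed
    have partial: "(\<Sum>i<N n. c i * indicator (S i) y) \<le> 1/2 - (1/2) ^ (n + 1)" for n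
    proof (induction n)
      case 0
      then show ?case by (simp add: N_def)
    next
      case (Suc n)
      have "{..<N (Suc n)} = {..<N n} \<union> {N n..<N (Suc n)}" using N_mono[of n] by auto
      then have "(\<Sum>i<N (Suc n). c i * indicator (S i) y)
          = (\<Sum>i<N n. c i * indicator (S i) y) + (\<Sum>i\<in>{N n..<N (Suc n)}. c i * indicator (S i) y)"
        by (simp only: sum.union_disjoint finite_lessThan finite_atLeastLessThan ivl_disj_int)
      also have "\<dots> \<le> 1/2 - (1/2) ^ (n + 1) + (1/2) ^ (n + 2)" by (intro add_mono Suc.IH blk)
      also have "\<dots> = 1/2 - (1/2) ^ (Suc n + 1)" by simp
      finally show ?case .
    qed
    have "(\<Sum>i. ennreal (c i) * indicator (S i) y) \<le> ennreal (1/2)"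
    proof (intro suminf_le_const summableI)
      fix n
      have "(\<Sum>i<n. ennreal (c i) * indicator (S i) y) = (\<Sum>i<n. ennreal (c i * indicator (S i) y))"
        by (intro sum.cong refl) (auto simp: indicator_def)
      also have "\<dots> = ennreal (\<Sum>i<n. c i * indicator (S i) y)"
        by (intro sum_ennreal) (simp add: nonneg)
      also have "\<dots> \<le> ennreal (1/2)"
      proof (intro ennreal_leI)
        have "(\<Sum>i<n. c i * indicator (S i) y) \<le> (\<Sum>i<N n. c i * indicator (S i) y)"
          using N_ge[of n] by (intro sum_mono2) (auto simp: nonneg)
        also have "\<dots> \<le> 1/2 - (1/2) ^ (n + 1)" by (rule partial)
        also have "\<dots> \<le> 1/2" by simp
        finally show "(\<Sum>i<n. c i * indicator (S i) y) \<le> 1/2" .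
      qed
      finally show "(\<Sum>i<n. ennreal (c i) * indicator (S i) y) \<le> ennreal (1/2)" .
    qed
    also have "\<dots> < 1" using ennreal_less_iff[of "1/2" 1] by (simp only: ennreal_1)
    finally show False using covers[OF y(1)] by simp
  qed
  then have "hausdorff_content q (10 * \<delta>) B \<le> hausdorff_content q (10 * \<delta>) (Z \<union> (\<Union>j. K j))"
    by (rule premeasure_mono)
  also have "\<dots> \<le> hausdorff_content q (10 * \<delta>) Z + hausdorff_content q (10 * \<delta>) (\<Union>j. K j)"
    using \<delta>_pos by (intro hausdorff.premeasure_subadditive) simp
  also have "hausdorff_content q (10 * \<delta>) Z \<le> (\<Sum>i. ennreal (diameter (S i) powr q) * indicator {i. diameter (S i) = 0} i)"
    using \<delta>_pos bounded unfolding Z_def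
    by (intro hausdorff.premeasure_le_indexed) (auto simp: small_sets_def)
  also have "(\<lambda>i. ennreal (diameter (S i) powr q) * indicator {i. diameter (S i) = 0} i) = (\<lambda>i. 0)"
    by (auto simp: indicator_def)
  also have "hausdorff_content q (10 * \<delta>) (\<Union>j. K j) \<le> (\<Sum>j. hausdorff_content q (10 * \<delta>) (K j))"
    by (rule premeasure_countably_subadditive)
  \<comment> \<open>Dividing the block cost \<open>M / 4 ^ j\<close> by the threshold leaves
    \<open>4 * M / 2 ^ j\<close>, whose sum is \<open>8 * M\<close>.\<close>
  also have "\<dots> \<le> (\<Sum>j. ennreal (4 * 10 powr q * M * (1/2) ^ j))"
  proof (intro suminf_le summableI)
    fix j
    have "hausdorff_content q (10 * \<delta>) (K j) \<le> ennreal (10 powr q * (\<Sum>i\<in>I j. a i) / (1/2) ^ (j + 2))"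
      unfolding a_def using \<delta>_pos
      by (intro content_weighted_bound) (auto simp: I_def K_def bounded diameter_le nonneg)
    also have "\<dots> \<le> ennreal (10 powr q * (M * (1/4) ^ j) / (1/2) ^ (j + 2))"
    proof (intro ennreal_leI divide_right_mono mult_left_mono)
      have "(\<Sum>i\<in>I j. a i) \<le> (\<Sum>i\<in>{N j..<N (Suc j)}. a i)"
        by (intro sum_mono2) (auto simp: I_def a0)
      also have "\<dots> \<le> M * (1/4) ^ j" by (rule block)
      finally show "(\<Sum>i\<in>I j. a i) \<le> M * (1/4) ^ j" .
    qed auto
    also have "10 powr q * (M * (1/4) ^ j) / (1/2) ^ (j + 2) = 4 * 10 powr q * M * (1/2) ^ j"
    proof -
      have "(1/4::real) ^ j = (1/2) ^ j * (1/2) ^ j" by (simp flip: power_mult_distrib)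
      then show ?thesis by (simp add: field_simps)
    qed
    finally show "hausdorff_content q (10 * \<delta>) (K j) \<le> ennreal (4 * 10 powr q * M * (1/2) ^ j)" .
  qed
  also have "\<dots> = ennreal (8 * 10 powr q * M)"
  proof (rule suminf_ennreal_eq)
    show "(\<lambda>j. 4 * 10 powr q * M * (1/2) ^ j) sums (8 * 10 powr q * M)"
      using sums_mult[OF geometric_sums[of "1/2::real"], of "4 * 10 powr q * M"] by (simp add: mult.assoc)
  qed (use M_pos in auto)
  finally show ?thesis by (simp add: add_mono)
qed

text \<open>Sets of the cover that are charged more than twice their cost contain a disjoint Vitali
  subfamily. Replacing that part of B by the subfamily would lower the content of B below
  its Hausdorff measure, so up to an error \<open>\<epsilon>\<close> such sets are absent, and integrating the weights
  over the rest of B gives the bound.\<close>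
lemma hausdorff_outer_le_add:
  assumes B: "B \<in> sets borel" and h: "hausdorff_outer q B = ennreal h" and \<epsilon>: "0 < \<epsilon>" "\<epsilon> \<le> h"
    and close: "\<And>\<delta>'. 0 < \<delta>' \<Longrightarrow> \<delta>' \<le> 10 * \<delta> \<Longrightarrow> ennreal (h - \<epsilon>) < hausdorff_content q \<delta>' B"
  shows "h \<le> 2 * M + (1 + 10 powr q) * \<epsilon>"
proof -
  let ?\<nu> = "hausdorff.borel_measure q :: 'a measure"
  have S_borel [measurable]: "S i \<in> sets borel" for i using closed by auto
  note B [measurable]
  have h0: "0 \<le> h" using \<epsilon> by simp
  define F where "F = {i. ennreal (2 * diameter (S i) powr q) < hausdorff_outer q (B \<inter> S i)}"
  have F_pos: "0 < diameter (S i)" if "i \<in> F" for i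
  proof (rule ccontr)
    assume "\<not> 0 < diameter (S i)"
    then have "diameter (S i) = 0" using diameter_ge_0[OF bounded, of i] by simp
    then have "hausdorff_outer q (S i) = 0" using bounded by (intro hausdorff_outer_diameter_zero)
    moreover have "hausdorff_outer q (B \<inter> S i) \<le> hausdorff_outer q (S i)" by (rule hausdorff.mono) auto
    ultimately show False using that by (simp add: F_def)
  qed
  obtain J where J: "J \<subseteq> F" "disjoint_family_on S J" "(\<Union>i\<in>F. S i) \<subseteq> (\<Union>i\<in>J. enlarge (S i))"
    using vitali_sets[of F S \<delta>] F_pos bounded diameter_le by blast
  define U where "U = (\<Union>i\<in>J. S i)"
  define V where "V = (\<Union>i\<in>J. enlarge (S i))"
  have U [measurable]: "U \<in> sets borel" unfolding U_def by auto
  have V [measurable]: "V \<in> sets borel" unfolding V_def by (intro sets.countable_UN'') (auto intro: closed_enlarge borel_closed)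
  have le_h: "hausdorff_outer q X \<le> ennreal h" if "X \<subseteq> B" for X
    using hausdorff.mono[OF that, of q] h by simp
  define s where "s = (\<Sum>i. ennreal (diameter (S i) powr q) * indicator J i)"
  \<comment> \<open>The sets indexed by \<open>J\<close> are disjoint and each carries more than
    twice its cost, so additivity of the Borel measure sums these inequalities.\<close>
  have s_le: "2 * s \<le> hausdorff_outer q (B \<inter> U)"
  proof -
    define A where "A i = (if i \<in> J then B \<inter> S i else {})" for i
    have "2 * s = (\<Sum>i. 2 * (ennreal (diameter (S i) powr q) * indicator J i))"
      unfolding s_def by simp
    also have "\<dots> \<le> (\<Sum>i. hausdorff_outer q (A i))"
    proof (intro suminf_le summableI)
      fix i
      show "2 * (ennreal (diameter (S i) powr q) * indicator J i) \<le> hausdorff_outer q (A i)"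
      proof (cases "i \<in> J")
        case True
        then have "ennreal (2 * diameter (S i) powr q) \<le> hausdorff_outer q (B \<inter> S i)"
          using J(1) by (auto simp: F_def)
        then show ?thesis using True by (simp add: A_def ennreal_mult')
      qed simp
    qed
    also have "\<dots> = (\<Sum>i. emeasure ?\<nu> (A i))"
      by (intro suminf_cong) (auto simp: A_def)
    also have "\<dots> = emeasure ?\<nu> (\<Union>i. A i)"
      using J(2) by (intro suminf_emeasure) (auto simp: A_def disjoint_family_on_def)
    also have "(\<Union>i. A i) = B \<inter> U" by (auto simp: A_def U_def split: if_splits)
    finally show ?thesis by simp
  qed
  obtain u where u: "0 \<le> u" "hausdorff_outer q (B \<inter> U) = ennreal u"
    using le_h[of "B \<inter> U"] by (cases "hausdorff_outer q (B \<inter> U)") (auto simp: top_unique)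
  obtain w where w: "0 \<le> w" "hausdorff_outer q (B - U) = ennreal w"
    using le_h[of "B - U"] by (cases "hausdorff_outer q (B - U)") (auto simp: top_unique)
  have "2 * s < top" using s_le u by (simp add: le_less_trans)
  then obtain s' where s': "0 \<le> s'" "s = ennreal s'"
    by (cases s) (auto simp: ennreal_mult_eq_top_iff)
  have "2 * s' \<le> u" using s_le u s' by (simp flip: ennreal_mult' ennreal_numeral)
  have "ennreal h = ennreal u + ennreal w"
  proof -
    have "emeasure ?\<nu> (B \<inter> U) + emeasure ?\<nu> (B - U) = emeasure ?\<nu> ((B \<inter> U) \<union> (B - U))"
      by (rule plus_emeasure) auto
    also have "(B \<inter> U) \<union> (B - U) = B" by auto
    finally show ?thesis using u w h by simp
  qed
  then have huw: "h = u + w" using u(1) w(1) h0 by (simp flip: ennreal_plus)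
  have \<delta>10: "0 < 10 * \<delta>" using \<delta>_pos by simp
  have diameter_le10: "diameter (S i) \<le> 10 * \<delta>" for i using diameter_le[of i] \<delta>_pos by simp
  have content_U: "hausdorff_content q (10 * \<delta>) (B \<inter> U) \<le> s"
    unfolding s_def using \<delta>10 bounded diameter_le10
    by (intro hausdorff.premeasure_le_indexed) (auto simp: small_sets_def U_def)
  \<comment> \<open>Covering \<open>B \<inter> U\<close> by the selected sets bounds the content of
    \<open>B\<close> by \<open>s' + w\<close>, while \<open>h = u + w\<close> is at least
    \<open>2 * s' + w\<close>. Hence \<open>s' \<le> \<epsilon>\<close>.\<close>
  have "ennreal (h - \<epsilon>) < hausdorff_content q (10 * \<delta>) ((B \<inter> U) \<union> (B - U))"
    using close[OF \<delta>10] by (simp add: Int_Diff_Un)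
  also have "\<dots> \<le> hausdorff_content q (10 * \<delta>) (B \<inter> U) + hausdorff_content q (10 * \<delta>) (B - U)"
    by (rule hausdorff.premeasure_subadditive[OF \<delta>10])
  also have "\<dots> \<le> s + hausdorff_outer q (B - U)"
    by (intro add_mono content_U hausdorff.premeasure_le_outer \<delta>10)
  also have "\<dots> = ennreal (s' + w)" using s' w by simp
  finally have "h - \<epsilon> < s' + w" using \<epsilon> by (simp add: ennreal_less_iff)
  with huw \<open>2 * s' \<le> u\<close> have s'_le: "s' \<le> \<epsilon>" by simp
  \<comment> \<open>The enlargements cost \<open>10 powr q\<close> times as much as the selected
    sets and have diameter at most \<open>10 * \<delta>\<close>, which explains the scale used for
    the content.\<close>
  have content_V: "hausdorff_content q (10 * \<delta>) (B \<inter> V) \<le> ennreal (10 powr q * \<epsilon>)"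
  proof -
    have "hausdorff_content q (10 * \<delta>) (B \<inter> V) \<le> (\<Sum>i. ennreal (diameter (enlarge (S i)) powr q) * indicator J i)"
      using \<delta>10 diameter_le bounded
      by (intro hausdorff.premeasure_le_indexed)
        (auto simp: small_sets_def V_def bounded_enlarge diameter_enlarge)
    also have "\<dots> = (\<Sum>i. ennreal (10 powr q) * (ennreal (diameter (S i) powr q) * indicator J i))"
      using diameter_ge_0 bounded
      by (intro suminf_cong) (auto simp: diameter_enlarge powr_mult ennreal_mult' indicator_def)
    also have "\<dots> = ennreal (10 powr q) * s" unfolding s_def by simp
    also have "\<dots> = ennreal (10 powr q * s')" using s' by (simp add: ennreal_mult')
    also have "\<dots> \<le> ennreal (10 powr q * \<epsilon>)" using s'_le by (intro ennreal_leI) simp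
    finally show ?thesis .
  qed
  \<comment> \<open>Integrate the covering inequality over \<open>B - V\<close>. Sets with index in
    \<open>F\<close> miss \<open>B - V\<close>; each of the others meets it in measure at most twice
    its cost.\<close>
  have rest: "hausdorff_outer q (B - V) \<le> ennreal (2 * M)"
  proof -
    have "hausdorff_outer q (B - V) = (\<integral>\<^sup>+ y. indicator (B - V) y \<partial>?\<nu>)" by simp
    also have "\<dots> \<le> (\<integral>\<^sup>+ y. (\<Sum>i. ennreal (c i) * indicator (S i \<inter> (B - V)) y) \<partial>?\<nu>)"
    proof (rule nn_integral_mono)
      fix y
      show "indicator (B - V) y \<le> (\<Sum>i. ennreal (c i) * indicator (S i \<inter> (B - V)) y)"
        using covers[of y] by (cases "y \<in> B - V") (auto simp: indicator_inter_arith)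
    qed
    also have "\<dots> = (\<Sum>i. \<integral>\<^sup>+ y. ennreal (c i) * indicator (S i \<inter> (B - V)) y \<partial>?\<nu>)"
      by (rule nn_integral_suminf) measurable
    also have "\<dots> = (\<Sum>i. ennreal (c i) * hausdorff_outer q (S i \<inter> (B - V)))"
      by (intro suminf_cong) (simp add: nn_integral_cmult_indicator)
    also have "\<dots> \<le> (\<Sum>i. 2 * ennreal (c i * diameter (S i) powr q))"
    proof (intro suminf_le summableI)
      fix i
      have "hausdorff_outer q (S i \<inter> (B - V)) \<le> ennreal (2 * diameter (S i) powr q)"
      proof (cases "i \<in> F")
        case True
        then have "S i \<inter> (B - V) = {}" using J(3) by (auto simp: V_def)
        then show ?thesis by simp
      next
        case False
        have "hausdorff_outer q (S i \<inter> (B - V)) \<le> hausdorff_outer q (B \<inter> S i)"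
          by (rule hausdorff.mono) auto
        with False show ?thesis by (auto simp: F_def intro: order_trans)
      qed
      then have "ennreal (c i) * hausdorff_outer q (S i \<inter> (B - V)) \<le> ennreal (c i) * ennreal (2 * diameter (S i) powr q)"
        by (rule mult_left_mono) simp
      also have "\<dots> = 2 * ennreal (c i * diameter (S i) powr q)"
        using nonneg by (simp add: ennreal_mult' mult_ac)
      finally show "ennreal (c i) * hausdorff_outer q (S i \<inter> (B - V)) \<le> 2 * ennreal (c i * diameter (S i) powr q)" .
    qed
    also have "\<dots> = 2 * (\<Sum>i. ennreal (c i * diameter (S i) powr q))" by simp
    also have "\<dots> \<le> 2 * ennreal M" by (intro mult_left_mono cost_le) simp
    also have "\<dots> = ennreal (2 * M)" by (simp add: ennreal_mult')
    finally show ?thesis .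
  qed
  have "ennreal (h - \<epsilon>) < hausdorff_content q (10 * \<delta>) ((B \<inter> V) \<union> (B - V))"
    using close[OF \<delta>10] by (simp add: Int_Diff_Un)
  also have "\<dots> \<le> hausdorff_content q (10 * \<delta>) (B \<inter> V) + hausdorff_content q (10 * \<delta>) (B - V)"
    by (rule hausdorff.premeasure_subadditive[OF \<delta>10])
  also have "\<dots> \<le> ennreal (10 powr q * \<epsilon>) + ennreal (2 * M)"
    using hausdorff.premeasure_le_outer[OF \<delta>10, of q "B - V"] rest
    by (intro add_mono content_V) (rule order_trans)
  also have "\<dots> = ennreal (10 powr q * \<epsilon> + 2 * M)" using \<epsilon> M_pos by (intro ennreal_plus[symmetric]) auto
  finally have "h - \<epsilon> < 10 powr q * \<epsilon> + 2 * M" using \<epsilon> by (simp add: ennreal_less_iff)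
  then show ?thesis by (simp add: algebra_simps)
qed

end

text \<open>\<open>content_le\<close> at all scales gives finiteness of the measure. Only then is
  there a scale below which the content is within \<open>\<epsilon>\<close> of the measure, as
  \<open>hausdorff_outer_le_add\<close> demands; finally \<open>\<epsilon>\<close> tends to
  0.\<close>

lemma hausdorff_outer_le_weighted:
  fixes B :: "'a::euclidean_space set"
  assumes B: "B \<in> sets borel" and M: "0 < M"
    and cover: "\<And>\<delta>. 0 < \<delta> \<Longrightarrow> \<exists>S c. weighted_cover q \<delta> M S c B"
  shows "hausdorff_outer q B \<le> ennreal (2 * M)"
proof -
  have "hausdorff_outer q B \<le> ennreal (8 * 10 powr q * M)"
  proof (rule hausdorff.outer_le)
    fix \<delta> :: real assume "0 < \<delta>"
    then obtain S c where "weighted_cover q (\<delta> / 10) M S c B" using cover[of "\<delta> / 10"] by auto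
    from weighted_cover.content_le[OF this] show "hausdorff_content q \<delta> B \<le> ennreal (8 * 10 powr q * M)" by simp
  qed
  then obtain h where h: "0 \<le> h" "hausdorff_outer q B = ennreal h"
    by (cases "hausdorff_outer q B") (auto simp: top_unique)
  have "h \<le> 2 * M + e" if "0 < e" for e
  proof -
    define \<epsilon> where "\<epsilon> = e / (1 + 10 powr q)"
    have "0 < 1 + 10 powr q" by (simp add: add_pos_pos)
    then have \<epsilon>: "0 < \<epsilon>" "(1 + 10 powr q) * \<epsilon> = e" using that by (simp_all add: \<epsilon>_def)
    show ?thesis
    proof (cases "\<epsilon> \<le> h")
      case True
      then have "ennreal (h - \<epsilon>) < hausdorff_outer q B" using h \<epsilon> by (simp add: ennreal_less_iff)
      then obtain \<delta>\<^sub>0 where \<delta>\<^sub>0: "0 < \<delta>\<^sub>0" "\<And>\<delta>. 0 < \<delta> \<Longrightarrow> \<delta> \<le> \<delta>\<^sub>0 \<Longrightarrow> ennreal (h - \<epsilon>) < hausdorff_content q \<delta> B"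
        by (rule hausdorff.less_outerE) blast
      obtain S c where "weighted_cover q (\<delta>\<^sub>0 / 10) M S c B" using cover[of "\<delta>\<^sub>0 / 10"] \<delta>\<^sub>0(1) by auto
      from weighted_cover.hausdorff_outer_le_add[OF this B h(2) \<epsilon>(1) True] \<delta>\<^sub>0(2) \<epsilon>(2)
      show ?thesis by simp
    next
      case False
      moreover have "\<epsilon> \<le> e" using \<epsilon> by (simp add: algebra_simps flip: \<epsilon>(2))
      ultimately show ?thesis using M by simp
    qed
  qed
  then have "h \<le> 2 * M" by (rule field_le_epsilon)
  then show ?thesis using h by (simp add: ennreal_leI)
qed

section \<open>The mapping content\<close>

definition compact_sets :: "real \<Rightarrow> 'a::metric_space set set" where
  "compact_sets \<delta> = {D. compact D \<and> diameter D \<le> \<delta>}"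

text \<open>The extra bound on the image makes the images of a cover admissible for Hausdorff
  content at the same scale.\<close>

definition compact_image_sets :: "('a::metric_space \<Rightarrow> 'b::metric_space) \<Rightarrow> real \<Rightarrow> 'a set set" where
  "compact_image_sets f \<delta> = {D. compact D \<and> diameter D \<le> \<delta> \<and> diameter (f ` D) \<le> \<delta>}"

definition mapping_gauge :: "real \<Rightarrow> real \<Rightarrow> ('a::metric_space \<Rightarrow> 'b::metric_space) \<Rightarrow> 'a set \<Rightarrow> ennreal" where
  "mapping_gauge \<mu> q f D = ennreal (diameter D powr \<mu> * diameter (f ` D) powr q)"

interpretation psi: gauge_family compact_sets "mapping_gauge \<mu> q f"
  rewrites "gauge_family.outer compact_sets (mapping_gauge \<mu> q f) = Psi \<mu> q f"
  for \<mu> q :: real and f :: "'a::metric_space \<Rightarrow> 'b::metric_space"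
proof -
  show "gauge_family compact_sets (mapping_gauge \<mu> q f)"
    by unfold_locales
      (auto simp: compact_sets_def mapping_gauge_def intro: diameter_bounded_bound[OF compact_imp_bounded, THEN order_trans])
  then interpret gauge_family compact_sets "mapping_gauge \<mu> q f" .
  show "outer = Psi \<mu> q f"
    by (simp add: fun_eq_iff outer_def Psi_def premeasure_def compact_sets_def mapping_gauge_def)
qed

definition Psi_image :: "real \<Rightarrow> real \<Rightarrow> ('a::metric_space \<Rightarrow> 'b::metric_space) \<Rightarrow> 'a set \<Rightarrow> ennreal" where
  "Psi_image \<mu> q f E = (SUP \<delta>\<in>{0<..}. premeasure (compact_image_sets f \<delta>) (mapping_gauge \<mu> q f) E)"

interpretation psi_image: gauge_family "compact_image_sets f" "mapping_gauge \<mu> q f"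
  rewrites "gauge_family.outer (compact_image_sets f) (mapping_gauge \<mu> q f) = Psi_image \<mu> q f"
  for \<mu> q :: real and f :: "'a::metric_space \<Rightarrow> 'b::metric_space"
proof -
  show "gauge_family (compact_image_sets f) (mapping_gauge \<mu> q f)"
    by unfold_locales
      (auto simp: compact_image_sets_def mapping_gauge_def intro: diameter_bounded_bound[OF compact_imp_bounded, THEN order_trans])
  then interpret gauge_family "compact_image_sets f" "mapping_gauge \<mu> q f" .
  show "outer = Psi_image \<mu> q f"
    by (simp add: fun_eq_iff outer_def Psi_image_def)
qed

text \<open>On bounded sets uniform continuity makes the additional restriction on the diameters of the
  images harmless; Borel measurability of balls extends this to all sets.\<close>
lemma Psi_image_le_Psi:
  fixes f :: "'a::heine_borel \<Rightarrow> 'b::real_normed_vector"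
  assumes f: "continuous_on UNIV f" and "0 \<le> \<mu>" "0 \<le> q"
  shows "Psi_image \<mu> q f E \<le> Psi \<mu> q f E"
proof (rule psi_image.le_if_bounded_parts_le[where a = undefined])
  fix k :: nat
  define K :: "'a set" where "K = cball undefined (real k)"
  have K: "compact K" by (simp add: K_def)
  have "Psi_image \<mu> q f (E \<inter> K) \<le> Psi \<mu> q f E"
  proof (rule psi_image.outer_le)
    fix \<delta> :: real assume \<delta>: "0 < \<delta>"
    have "uniformly_continuous_on K f"
      using K f by (intro compact_uniformly_continuous) (auto intro: continuous_on_subset)
    then obtain \<eta> where \<eta>: "0 < \<eta>" "\<And>x y. x \<in> K \<Longrightarrow> y \<in> K \<Longrightarrow> dist x y < \<eta> \<Longrightarrow> dist (f x) (f y) < \<delta>"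
      using \<delta> unfolding uniformly_continuous_on_def by metis
    \<comment> \<open>Half of \<open>\<eta>\<close> turns the bound on diameters into the strict
      inequality of uniform continuity.\<close>
    define \<delta>' where "\<delta>' = min \<delta> (\<eta> / 2)"
    have \<delta>': "0 < \<delta>'" "\<delta>' \<le> \<delta>" "\<delta>' < \<eta>" using \<delta> \<eta>(1) by (auto simp: \<delta>'_def)
    have "premeasure (compact_image_sets f \<delta>) (mapping_gauge \<mu> q f) (E \<inter> K)
        \<le> premeasure (compact_sets \<delta>') (mapping_gauge \<mu> q f) E"
      unfolding premeasure_def[of "compact_sets \<delta>'"]
    proof (intro INF_greatest)
      fix D :: "nat \<Rightarrow> 'a set"
      assume "D \<in> {C. (\<forall>i. C i \<in> compact_sets \<delta>') \<and> E \<subseteq> (\<Union>i. C i)}"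
      then have D: "\<And>i. compact (D i)" "\<And>i. diameter (D i) \<le> \<delta>'" and E: "E \<subseteq> (\<Union>i. D i)"
        by (auto simp: compact_sets_def)
      have fb: "bounded (f ` D i)" for i
        using D(1) f by (intro compact_imp_bounded compact_continuous_image) (auto intro: continuous_on_subset)
      \<comment> \<open>Intersecting the cover with \<open>K\<close> gives access to the modulus
        \<open>\<eta>\<close>, and cannot increase the gauge.\<close>
      have "premeasure (compact_image_sets f \<delta>) (mapping_gauge \<mu> q f) (E \<inter> K) \<le> (\<Sum>i. mapping_gauge \<mu> q f (D i \<inter> K))"
      proof (rule premeasure_le)
        fix i
        have "diameter (D i \<inter> K) \<le> diameter (D i)"
          using D(1) by (intro diameter_subset compact_imp_bounded) auto
        moreover have "diameter (f ` (D i \<inter> K)) \<le> \<delta>"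
        proof (rule diameter_le)
          fix u v assume "u \<in> f ` (D i \<inter> K)" "v \<in> f ` (D i \<inter> K)"
          then obtain x y where xy: "x \<in> D i" "x \<in> K" "u = f x" "y \<in> D i" "y \<in> K" "v = f y" by auto
          have "dist x y \<le> diameter (D i)"
            using xy D(1) by (intro diameter_bounded_bound compact_imp_bounded)
          also have "\<dots> < \<eta>" using D(2)[of i] \<delta>'(3) by simp
          finally show "norm (u - v) \<le> \<delta>" using \<eta>(2) xy by (auto simp: dist_norm less_imp_le)
        qed (use \<delta> in auto)
        ultimately show "D i \<inter> K \<in> compact_image_sets f \<delta>"
          using D[of i] \<delta>' K by (auto simp: compact_image_sets_def)
      qed (use E in auto)
      also have "\<dots> \<le> (\<Sum>i. mapping_gauge \<mu> q f (D i))"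
        unfolding mapping_gauge_def
      proof (intro suminf_le summableI ennreal_leI mult_mono powr_mono2 diameter_subset diameter_ge_0)
        show "bounded (D i)" "bounded (D i \<inter> K)" for i
          using compact_imp_bounded[OF D(1), of i] by auto
        show "bounded (f ` (D i \<inter> K))" for i
          using fb[of i] by (rule bounded_subset) auto
      qed (use assms fb in auto)
      finally show "premeasure (compact_image_sets f \<delta>) (mapping_gauge \<mu> q f) (E \<inter> K) \<le> (\<Sum>i. mapping_gauge \<mu> q f (D i))" .
    qed
    also have "\<dots> \<le> Psi \<mu> q f E" using \<delta>'(1) by (rule psi.premeasure_le_outer)
    finally show "premeasure (compact_image_sets f \<delta>) (mapping_gauge \<mu> q f) (E \<inter> K) \<le> Psi \<mu> q f E" .
  qed
  then show "Psi_image \<mu> q f (E \<inter> cball undefined (real k)) \<le> Psi \<mu> q f E"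
    by (simp add: K_def)
qed

text \<open>The fibre over \<open>y\<close> is covered by those \<open>D j i\<close> whose image
  contains \<open>y\<close>, so \<open>g j y\<close> bounds its content at scale \<open>r j\<close>.
  Large fibres therefore force \<open>g j y \<ge> lam / 2\<close> for all large \<open>j\<close>,
  which turns the images into weighted covers of cost \<open>2 * p / lam\<close>.\<close>

lemma hausdorff_outer_fibre_le:
  fixes f :: "'a::heine_borel \<Rightarrow> 'b::euclidean_space"
  assumes f: "continuous_on UNIV f" and \<mu>: "0 \<le> \<mu>" and q: "0 \<le> q" and lam: "0 < lam" and p: "0 < p" "Psi \<mu> q f E < ennreal p"
  shows "hausdorff_outer q {y. ennreal lam \<le> hausdorff_outer \<mu> (E \<inter> f -` {y})} \<le> ennreal (4 * p / lam)"
proof -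
  let ?\<nu> = "hausdorff.borel_measure q :: 'b measure"
  define r where "r j = 1 / (real j + 1)" for j :: nat
  have r_pos: "0 < r j" for j by (simp add: r_def)
  have r_mono: "r j \<le> r k" if "k \<le> j" for j k using that by (simp add: r_def field_simps)
  have r_ex: "\<exists>k. r k \<le> \<delta>" if "0 < \<delta>" for \<delta>
    using reals_Archimedean[OF that] by (metis inverse_eq_divide less_imp_le of_nat_Suc add.commute r_def)
  have "\<exists>D :: nat \<Rightarrow> 'a set. (\<forall>i. D i \<in> compact_image_sets f (r j)) \<and> E \<subseteq> (\<Union>i. D i) \<and>
      (\<Sum>i. mapping_gauge \<mu> q f (D i)) < ennreal p" for j
  proof -
    have "premeasure (compact_image_sets f (r j)) (mapping_gauge \<mu> q f) E < ennreal p"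
      using psi_image.premeasure_le_outer[OF r_pos] Psi_image_le_Psi[OF f \<mu> q] p(2) by (meson le_less_trans)
    then show ?thesis by (rule premeasure_less_cover) blast
  qed
  then obtain D where D: "\<And>j i. D j i \<in> compact_image_sets f (r j)" "\<And>j. E \<subseteq> (\<Union>i::nat. D j i)"
      "\<And>j. (\<Sum>i. mapping_gauge \<mu> q f (D j i)) < ennreal p"
    by metis
  have D_compact: "compact (D j i)" and D_diam: "diameter (D j i) \<le> r j" "diameter (f ` D j i) \<le> r j" for j i
    using D(1)[of j i] by (auto simp: compact_image_sets_def)
  have fD: "compact (f ` D j i)" for j i
    using D_compact f by (intro compact_continuous_image) (auto intro: continuous_on_subset)
  have fD_borel [measurable]: "f ` D j i \<in> sets borel" for j i
    using fD by (intro borel_closed compact_imp_closed)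
  define g where "g j y = (\<Sum>i. ennreal (diameter (D j i) powr \<mu>) * indicator (f ` D j i) y)" for j y
  have g_meas [measurable]: "g j \<in> borel_measurable borel" for j unfolding g_def by measurable
  \<comment> \<open>The sets \<open>G m\<close> are Borel, as countable intersections, and increase
    with \<open>m\<close>. Their union replaces the set in question, whose measurability is left
    open.\<close>
  define G where "G m = {y. \<forall>j\<ge>m. ennreal (lam / 2) \<le> g j y}" for m
  have G_borel: "G m \<in> sets borel" for m
  proof -
    have "G m = (\<Inter>j\<in>{m..}. {y \<in> space borel. ennreal (lam / 2) \<le> g j y})" by (auto simp: G_def)
    also have "\<dots> \<in> sets borel" by (intro sets.countable_INT') auto
    finally show ?thesis .
  qed
  have "{y. ennreal lam \<le> hausdorff_outer \<mu> (E \<inter> f -` {y})} \<subseteq> (\<Union>m. G m)"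
  proof
    fix y assume "y \<in> {y. ennreal lam \<le> hausdorff_outer \<mu> (E \<inter> f -` {y})}"
    then have "ennreal lam \<le> hausdorff_outer \<mu> (E \<inter> f -` {y})" by simp
    \<comment> \<open>A strict inequality is required to pass from the supremum to a small scale.
      Halving \<open>lam\<close> costs a factor 2, which combines with that of
      \<open>hausdorff_outer_le_weighted\<close> to 4.\<close>
    moreover have "ennreal (lam / 2) < ennreal lam" using lam by (simp add: ennreal_less_iff)
    ultimately have "ennreal (lam / 2) < hausdorff_outer \<mu> (E \<inter> f -` {y})" by (rule less_le_trans[rotated])
    then obtain \<delta>\<^sub>0 where \<delta>\<^sub>0: "0 < \<delta>\<^sub>0"
        "\<And>\<delta>. 0 < \<delta> \<Longrightarrow> \<delta> \<le> \<delta>\<^sub>0 \<Longrightarrow> ennreal (lam / 2) < hausdorff_content \<mu> \<delta> (E \<inter> f -` {y})"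
      by (rule hausdorff.less_outerE) blast
    obtain m where m: "r m \<le> \<delta>\<^sub>0" using r_ex \<delta>\<^sub>0(1) by blast
    have "ennreal (lam / 2) \<le> g j y" if "m \<le> j" for j
    proof -
      have "ennreal (lam / 2) \<le> hausdorff_content \<mu> (r j) (E \<inter> f -` {y})"
        using \<delta>\<^sub>0(2)[OF r_pos, of j] r_mono[OF that] m by simp
      also have "\<dots> \<le> (\<Sum>i. ennreal (diameter (D j i) powr \<mu>) * indicator {i. y \<in> f ` D j i} i)"
      proof (rule hausdorff.premeasure_le_indexed)
        show "E \<inter> f -` {y} \<subseteq> (\<Union>i\<in>{i. y \<in> f ` D j i}. D j i)"
          using D(2)[of j] by blast
      qed (use r_pos D_compact D_diam in \<open>auto simp: small_sets_def compact_imp_bounded\<close>)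
      also have "\<dots> = g j y" unfolding g_def by (simp add: indicator_def)
      finally show ?thesis .
    qed
    then show "y \<in> (\<Union>m. G m)" by (auto simp: G_def)
  qed
  then have "hausdorff_outer q {y. ennreal lam \<le> hausdorff_outer \<mu> (E \<inter> f -` {y})} \<le> hausdorff_outer q (\<Union>m. G m)"
    by (rule hausdorff.mono)
  also have "\<dots> = emeasure ?\<nu> (\<Union>m. G m)"
    using G_borel by (intro hausdorff.emeasure_borel_measure[symmetric]) auto
  also have "\<dots> = (SUP m. emeasure ?\<nu> (G m))"
  proof (rule SUP_emeasure_incseq[symmetric])
    show "incseq G" by (auto simp: incseq_def G_def)
  qed (use G_borel in auto)
  also have "\<dots> \<le> ennreal (4 * p / lam)"
  proof (rule SUP_least)
    fix m
    have "hausdorff_outer q (G m) \<le> ennreal (2 * (2 * p / lam))"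
    proof (rule hausdorff_outer_le_weighted[OF G_borel])
      show "0 < 2 * p / lam" using p lam by simp
      fix \<delta> :: real assume "0 < \<delta>"
      then obtain k where k: "r k \<le> \<delta>" using r_ex by blast
      \<comment> \<open>The index must reach \<open>m\<close> for the bound defining
        \<open>G m\<close>, and \<open>k\<close> for the scale \<open>\<delta>\<close>.\<close>
      define j where "j = max m k"
      have j: "m \<le> j" "r j \<le> \<delta>" using k r_mono[of k j] by (auto simp: j_def)
      have "weighted_cover q \<delta> (2 * p / lam) (\<lambda>i. f ` D j i) (\<lambda>i. 2 / lam * diameter (D j i) powr \<mu>) (G m)"
      proof
        show "0 < \<delta>" "0 < 2 * p / lam" by fact+
        show "closed (f ` D j i)" "bounded (f ` D j i)" for i
          using fD by (auto intro: compact_imp_closed compact_imp_bounded)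
        show "diameter (f ` D j i) \<le> \<delta>" for i using D_diam(2)[of j i] j(2) by simp
        show "0 \<le> 2 / lam * diameter (D j i) powr \<mu>" for i using lam by simp
        show "1 \<le> (\<Sum>i. ennreal (2 / lam * diameter (D j i) powr \<mu>) * indicator (f ` D j i) y)" if "y \<in> G m" for y
        proof -
          have "1 = ennreal (2 / lam) * ennreal (lam / 2)" using lam by (simp flip: ennreal_mult')
          also have "\<dots> \<le> ennreal (2 / lam) * g j y" using that j(1) by (intro mult_left_mono) (auto simp: G_def)
          also have "\<dots> = (\<Sum>i. ennreal (2 / lam * diameter (D j i) powr \<mu>) * indicator (f ` D j i) y)"
            unfolding g_def ennreal_suminf_cmult[symmetric] using lam
            by (intro suminf_cong) (simp only: ennreal_mult' divide_nonneg_pos zero_le_numeral mult.assoc)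
          finally show ?thesis .
        qed
        have "(\<Sum>i. ennreal (2 / lam * diameter (D j i) powr \<mu> * diameter (f ` D j i) powr q))
            = (\<Sum>i. ennreal (2 / lam) * mapping_gauge \<mu> q f (D j i))"
          using lam unfolding mapping_gauge_def
          by (intro suminf_cong) (simp only: ennreal_mult' divide_nonneg_pos zero_le_numeral mult.assoc)
        also have "\<dots> = ennreal (2 / lam) * (\<Sum>i. mapping_gauge \<mu> q f (D j i))" by simp
        also have "\<dots> \<le> ennreal (2 / lam) * ennreal p" using D(3)[of j] by (intro mult_left_mono) auto
        also have "\<dots> = ennreal (2 * p / lam)" using lam p by (simp flip: ennreal_mult')
        finally show "(\<Sum>i. ennreal (2 / lam * diameter (D j i) powr \<mu> * diameter (f ` D j i) powr q)) \<le> ennreal (2 * p / lam)" .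
      qed
      then show "\<exists>S c. weighted_cover q \<delta> (2 * p / lam) S c (G m)" by blast
    qed
    then show "emeasure ?\<nu> (G m) \<le> ennreal (4 * p / lam)" using G_borel by simp
  qed
  finally show ?thesis .
qed

theorem theorem6p3:
  fixes f :: "real^'n \<Rightarrow> real^'d" and \<mu> q :: real
  assumes "0 < \<mu>" "\<mu> \<le> real CARD('n)"
    and "0 < q" "q \<le> real CARD('d)"
    and "continuous_on UNIV f"
  shows "(\<forall>E :: nat \<Rightarrow> (real^'n) set. Psi \<mu> q f (\<Union>i. E i) \<le> (\<Sum>i. Psi \<mu> q f (E i)))
    \<and> (\<forall>(E :: (real^'n) set) (lam::real). lam > 0 \<longrightarrow>
         hausdorff_outer q {y :: real^'d. hausdorff_outer \<mu> (E \<inter> f -` {y}) \<ge> ennreal lam}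
           \<le> 5 * Psi \<mu> q f E / ennreal lam)"
proof (intro conjI allI impI)
  show "Psi \<mu> q f (\<Union>i. E i) \<le> (\<Sum>i. Psi \<mu> q f (E i))" for E :: "nat \<Rightarrow> (real^'n) set"
    by (rule psi.countably_subadditive)
  fix E :: "(real^'n) set" and lam :: real assume lam: "lam > 0"
  show "hausdorff_outer q {y :: real^'d. hausdorff_outer \<mu> (E \<inter> f -` {y}) \<ge> ennreal lam}
      \<le> 5 * Psi \<mu> q f E / ennreal lam"
  proof (cases "Psi \<mu> q f E")
    case (real p)
    have "hausdorff_outer q {y :: real^'d. hausdorff_outer \<mu> (E \<inter> f -` {y}) \<ge> ennreal lam} \<le> ennreal (4 * p / lam)"
    proof (rule ennreal_le_epsilon)
      fix e :: real assume e: "0 < e"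
      \<comment> \<open>\<open>hausdorff_outer_fibre_le\<close> asks for a strict upper bound of
        \<open>Psi\<close>; this choice raises the estimate by exactly \<open>e\<close>.\<close>
      define p' where "p' = p + e * lam / 4"
      have p': "p < p'" using e lam by (simp add: p'_def)
      have "hausdorff_outer q {y :: real^'d. hausdorff_outer \<mu> (E \<inter> f -` {y}) \<ge> ennreal lam} \<le> ennreal (4 * p' / lam)"
        using assms lam real p' by (intro hausdorff_outer_fibre_le) (auto simp: ennreal_less_iff)
      also have "4 * p' / lam = 4 * p / lam + e" using lam by (simp add: p'_def field_simps)
      also have "ennreal \<dots> = ennreal (4 * p / lam) + ennreal e" using e lam real by (intro ennreal_plus) auto
      finally show "hausdorff_outer q {y :: real^'d. hausdorff_outer \<mu> (E \<inter> f -` {y}) \<ge> ennreal lam}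
          \<le> ennreal (4 * p / lam) + ennreal e" .
    qed
    also have "\<dots> \<le> ennreal (5 * p / lam)"
      using lam real by (intro ennreal_leI divide_right_mono) auto
    also have "\<dots> = 5 * Psi \<mu> q f E / ennreal lam"
      using lam real by (simp add: ennreal_mult' flip: divide_ennreal)
    finally show ?thesis .
  next
    case top
    \<comment> \<open>If \<open>Psi\<close> is infinite, so is the right-hand side, because
      \<open>lam\<close> is finite.\<close>
    then show ?thesis by (simp add: ennreal_mult_top ennreal_top_divide)
  qed
qed

end
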